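(* Let $\lambda\in\mathbb R$, $T>0$, and let $(\vec X^h(t),\kappa^h(t),\vec Y^h(t))\in \underline V^h\times V^h\times\underline V^h$, $t\in(0,T]$ (with $\vec X^h(0)\in\underline V^h$ given), be a solution of the semidiscrete scheme $(\mathcal P_h)^h$ defined in the context, with $\vec X^h$ and $\kappa^h$ differentiable in time and $\vec X^h$ taking values in $H$. Assume that for all $t\in[0,T]$ and all $j=1,\ldots,J$ $$\vec X^h(q_j,t)\neq\vec X^h(q_{j+1},t)\quad\text{and}\quad \vec X^h(q_{j-1},t)\neq\vec X^h(q_{j+1},t),$$ where $q_{J+1}=q_1$. Then the solution satisfies, for $t\in(0,T]$, $$\Bigl(g^{\frac32}(\vec X^h)\,(\vec X^h_t\cdot\vec\omega^h)^2,\,|\vec X^h_\rho|\Bigr)^h=-\frac{\rm d}{{\rm d}t}\,W^h_{g,\lambda}(\vec X^h,\kappa^h),$$ where $$W^h_{g,\lambda}(\vec X^h,\kappa^h)=\tfrac12\Bigl(g^{-\frac12}(\vec X^h)\bigl(\kappa^h-\tfrac12\tfrac{\vec\omega^h}{|\vec\omega^h|}\cdot\nabla\ln g(\vec X^h)\bigr)^2+2\lambda\,g^{\frac12}(\vec X^h),\,|\vec X^h_\rho|\Bigr)^h .$$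
   Context: **Metric.** $H\subset\mathbb R^2$ is open and $g:H\to(0,\infty)$ is smooth. $\nabla\ln g$ and $D^2\ln g$ are the Euclidean gradient and Hessian of $\ln g$. **Rotation.** $\cdot^\perp$ is clockwise rotation by $\pi/2$ in $\mathbb R^2$: $(a_1,a_2)^\perp=(a_2,-a_1)$. **Finite elements.** $I=\mathbb R/\mathbb Z$ is the periodic unit interval, $J\ge3$, $h=1/J$, $q_j=jh$ for $j=0,\dots,J$, with $q_0=q_J$ identified (indices are periodic), $I_j=[q_{j-1},q_j]$. $V^h$ is the space of continuous functions on $I$ that are affine on each $I_j$, and $\underline V^h=[V^h]^2$. **Inner products.** $(u,v)=\int_I u\cdot v\,{\rm d}\rho$ is the $L^2$ inner product on $I$. For piecewise continuous $u,v$ with possible jumps at the nodes, the mass-lumped product is $$(u,v)^h=\tfrac12 h\sum_{j=1}^J\bigl[(u\cdot v)(q_j^-)+(u\cdot v)(q_{j-1}^+)\bigr],$$ where $q^\pm$ denote one-sided limits. **Discrete geometry.** For $\vec X^h(t)\in\underline V^h$ with $|\vec X^h_\rho|>0$ on each element: $\partial_s=|\vec X^h_\rho|^{-1}\partial_\rho$ (elementwise), $\vec\tau^h=\vec X^h_s$, $\vec\nu^h=-(\vec\tau^h)^\perp$ (elementwise constant), and $\vec\omega^h\in\underline V^h$ is defined by $(\vec\omega^h,\vec\varphi\,|\vec X^h_\rho|)^h=(\vec\nu^h,\vec\varphi\,|\vec X^h_\rho|)^h$ for all $\vec\varphi\in\underline V^h$. Subscript $t$ denotes the time derivative. **Scheme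 $(\mathcal P_h)^h$.** Write $\vec n^h=\vec\omega^h/|\vec\omega^h|$ and $A^h=\kappa^h-\tfrac12\,\vec n^h\cdot\nabla\ln g(\vec X^h)$ (only nodal values are used). Given $\vec X^h(0)\in\underline V^h$, a solution is $(\vec X^h(t),\kappa^h(t),\vec Y^h(t))\in\underline V^h\times V^h\times\underline V^h$ such that for all $t\in(0,T]$ the following three equations hold. (i) For all $\vec\chi\in\underline V^h$: $$\begin{aligned} \bigl(g^{\frac32}(\vec X^h)\,\vec X^h_t\cdot\vec\omega^h,\ \vec\chi\cdot\vec\omega^h\,|\vec X^h_\rho|\bigr)^h ={}&\bigl(\vec Y^h_s\cdot\vec\nu^h,\ \vec\chi_s\cdot\vec\nu^h\,|\vec X^h_\rho|\bigr)\\ &-\tfrac12\bigl(g^{-\frac12}(\vec X^h)(A^h)^2+2\lambda g^{\frac12}(\vec X^h),\ \vec\chi_s\cdot\vec\tau^h\,|\vec X^h_\rho|\bigr)^h\\ &+\tfrac14\bigl(g^{-\frac12}(\vec X^h)(A^h)^2-2\lambda g^{\frac12}(\vec X^h),\ \vec\chi\cdot\nabla\ln g(\vec X^h)\,|\vec X^h_\rho|\bigr)^h\\ &+\tfrac12\bigl(g^{-\frac12}(\vec X^h)A^h\,\vec n^h,\ (D^2\ln g(\vec X^h))\,\vec\chi\,|\vec X^h_\rho|\bigr)^h\\ &-\tfrac12\Bigl(g^{-\frac12}(\vec X^h)A^h\,\tfrac{\nabla\ln g(\vec X^h)}{|\vec\omega^h|}\cdot(\vec n^h)^\perp,\ \vec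 n^h\cdot\vec\chi_s\,|\vec X^h_\rho|\Bigr)^h\\ &+\bigl(\kappa^h(\vec Y^h)^\perp,\ \vec\chi_s\,|\vec X^h_\rho|\bigr)^h . \end{aligned}$$ (ii) For all $\chi\in V^h$: $\ \bigl(g^{-\frac12}(\vec X^h)A^h-\vec Y^h\cdot\vec\nu^h,\ \chi\,|\vec X^h_\rho|\bigr)^h=0$. (iii) For all $\vec\eta\in\underline V^h$: $\ \bigl(\kappa^h\vec\nu^h,\vec\eta\,|\vec X^h_\rho|\bigr)^h+\bigl(\vec X^h_s,\vec\eta_s\,|\vec X^h_\rho|\bigr)=0$. *)

theory Defs
  imports "HOL-Analysis.Analysis"
begin

subsection \<open>Smoothness, gradient and Hessian\<close>

text \<open>\<open>C^k\<close> regularity on an open set, by recursion on partial derivatives.\<close>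

primrec cont_diff_on :: "nat \<Rightarrow> ('a::euclidean_space \<Rightarrow> real) \<Rightarrow> 'a set \<Rightarrow> bool" where
  "cont_diff_on 0 f S \<longleftrightarrow> continuous_on S f"
| "cont_diff_on (Suc k) f S \<longleftrightarrow>
     (\<forall>x\<in>S. f differentiable (at x)) \<and>
     (\<forall>b\<in>Basis. cont_diff_on k (\<lambda>x. frechet_derivative f (at x) b) S)"

definition smooth_on :: "('a::euclidean_space \<Rightarrow> real) \<Rightarrow> 'a set \<Rightarrow> bool" where
  "smooth_on f S \<longleftrightarrow> (\<forall>k. cont_diff_on k f S)"

definition grad :: "('a::real_inner \<Rightarrow> real) \<Rightarrow> 'a \<Rightarrow> 'a" where
  "grad f x = (THE D. GDERIV f x :> D)"

definition hess :: "(real^'n \<Rightarrow> real) \<Rightarrow> real^'n \<Rightarrow> real^'n^'n" where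
  "hess f x = jacobian (grad f) (at x)"

definition perp :: "real^2 \<Rightarrow> real^2" where
  "perp a = vector [a $ 2, - (a $ 1)]"


subsection \<open>Finite elements on the periodic unit interval\<close>

text \<open>Functions on \<open>\<real>/\<int>\<close> are represented by 1-periodic functions on the real line, so that
  \<open>node J j\<close> and \<open>node J (j + J)\<close> are the same point of the periodic interval.\<close>

definition node :: "nat \<Rightarrow> nat \<Rightarrow> real" where
  "node J j = real j * (1 / real J)"

definition Vh :: "nat \<Rightarrow> (real \<Rightarrow> 'a::real_normed_vector) set" where
  "Vh J = {f. (\<forall>\<rho>. f (\<rho> + 1) = f \<rho>) \<and> continuous_on UNIV f \<and>
      (\<forall>j\<in>{1..J}. \<exists>a b. \<forall>\<rho>\<in>{node J (j - 1)..node J j}. f \<rho> = a + \<rho> *\<^sub>R b)}"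

definition ip :: "(real \<Rightarrow> 'a::real_inner) \<Rightarrow> (real \<Rightarrow> 'a) \<Rightarrow> real" where
  "ip u v = integral {0..1} (\<lambda>\<rho>. u \<rho> \<bullet> v \<rho>)"

definition ip_h :: "nat \<Rightarrow> (real \<Rightarrow> 'a::real_inner) \<Rightarrow> (real \<Rightarrow> 'a) \<Rightarrow> real" where
  "ip_h J u v = 1/2 * (1 / real J) *
     (\<Sum>j=1..J. Lim (at_left (node J j)) (\<lambda>\<rho>. u \<rho> \<bullet> v \<rho>)
            + Lim (at_right (node J (j - 1))) (\<lambda>\<rho>. u \<rho> \<bullet> v \<rho>))"


subsection \<open>Discrete geometry of a polygonal curve\<close>

text \<open>For a finite element function, \<open>d_rho\<close> is the elementwise derivative; its (arbitrary)
  values at the nodes affect neither \<^const>\<open>ip\<close> nor the one-sided limits in \<^const>\<open>ip_h\<close>.\<close>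

definition d_rho :: "(real \<Rightarrow> 'a::real_normed_vector) \<Rightarrow> real \<Rightarrow> 'a" where
  "d_rho u \<rho> = vector_derivative u (at \<rho>)"

definition len :: "(real \<Rightarrow> real^2) \<Rightarrow> real \<Rightarrow> real" where
  "len X \<rho> = norm (d_rho X \<rho>)"

definition d_s :: "(real \<Rightarrow> real^2) \<Rightarrow> (real \<Rightarrow> 'a::real_normed_vector) \<Rightarrow> real \<Rightarrow> 'a" where
  "d_s X u \<rho> = inverse (len X \<rho>) *\<^sub>R d_rho u \<rho>"

definition tau_h :: "(real \<Rightarrow> real^2) \<Rightarrow> real \<Rightarrow> real^2" where
  "tau_h X = d_s X X"

definition nu_h :: "(real \<Rightarrow> real^2) \<Rightarrow> real \<Rightarrow> real^2" where
  "nu_h X \<rho> = - perp (tau_h X \<rho>)"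

definition omega_h :: "nat \<Rightarrow> (real \<Rightarrow> real^2) \<Rightarrow> real \<Rightarrow> real^2" where
  "omega_h J X = (THE w. w \<in> Vh J \<and>
     (\<forall>\<phi>\<in>Vh J. ip_h J w (\<lambda>\<rho>. len X \<rho> *\<^sub>R \<phi> \<rho>) = ip_h J (nu_h X) (\<lambda>\<rho>. len X \<rho> *\<^sub>R \<phi> \<rho>)))"

definition n_h :: "nat \<Rightarrow> (real \<Rightarrow> real^2) \<Rightarrow> real \<Rightarrow> real^2" where
  "n_h J X \<rho> = inverse (norm (omega_h J X \<rho>)) *\<^sub>R omega_h J X \<rho>"

definition A_h :: "nat \<Rightarrow> (real^2 \<Rightarrow> real) \<Rightarrow> (real \<Rightarrow> real^2) \<Rightarrow> (real \<Rightarrow> real) \<Rightarrow> real \<Rightarrow> real" where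
  "A_h J g X \<kappa> \<rho> = \<kappa> \<rho> - 1/2 * (n_h J X \<rho> \<bullet> grad (\<lambda>x. ln (g x)) (X \<rho>))"

definition W_h ::
  "nat \<Rightarrow> (real^2 \<Rightarrow> real) \<Rightarrow> real \<Rightarrow> (real \<Rightarrow> real^2) \<Rightarrow> (real \<Rightarrow> real) \<Rightarrow> real" where
  "W_h J g lam X \<kappa> = 1/2 * ip_h J
     (\<lambda>\<rho>. g (X \<rho>) powr (-1/2) *
            (\<kappa> \<rho> - 1/2 * ((inverse (norm (omega_h J X \<rho>)) *\<^sub>R omega_h J X \<rho>)
                          \<bullet> grad (\<lambda>x. ln (g x)) (X \<rho>)))\<^sup>2
          + 2 * lam * g (X \<rho>) powr (1/2))
     (len X)"


subsection \<open>The semidiscrete scheme\<close>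

text \<open>In the three equations below, \<open>X\<close>, \<open>\<kappa>\<close> and \<open>Y\<close> are the values of the solution
  at a fixed time, and \<open>Xt\<close> is the time derivative of the curve at that time.\<close>

definition scheme_i ::
  "nat \<Rightarrow> (real^2 \<Rightarrow> real) \<Rightarrow> real \<Rightarrow> (real \<Rightarrow> real^2) \<Rightarrow> (real \<Rightarrow> real^2) \<Rightarrow>
   (real \<Rightarrow> real) \<Rightarrow> (real \<Rightarrow> real^2) \<Rightarrow> bool" where
  "scheme_i J g lam X Xt \<kappa> Y \<longleftrightarrow>
    (let lng = (\<lambda>x. ln (g x)); \<omega> = omega_h J X; n = n_h J X; A = A_h J g X \<kappa>;
         \<tau> = tau_h X; \<nu> = nu_h X in
     \<forall>\<phi>\<in>Vh J.
       ip_h J (\<lambda>\<rho>. g (X \<rho>) powr (3/2) * (Xt \<rho> \<bullet> \<omega> \<rho>)) (\<lambda>\<rho>. (\<phi> \<rho> \<bullet> \<omega> \<rho>) * len X \<rho>)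
     = ip (\<lambda>\<rho>. d_s X Y \<rho> \<bullet> \<nu> \<rho>) (\<lambda>\<rho>. (d_s X \<phi> \<rho> \<bullet> \<nu> \<rho>) * len X \<rho>)
       - 1/2 * ip_h J
           (\<lambda>\<rho>. g (X \<rho>) powr (-1/2) * (A \<rho>)\<^sup>2 + 2 * lam * g (X \<rho>) powr (1/2))
           (\<lambda>\<rho>. (d_s X \<phi> \<rho> \<bullet> \<tau> \<rho>) * len X \<rho>)
       + 1/4 * ip_h J
           (\<lambda>\<rho>. g (X \<rho>) powr (-1/2) * (A \<rho>)\<^sup>2 - 2 * lam * g (X \<rho>) powr (1/2))
           (\<lambda>\<rho>. (\<phi> \<rho> \<bullet> grad lng (X \<rho>)) * len X \<rho>)
       + 1/2 * ip_h J
           (\<lambda>\<rho>. (g (X \<rho>) powr (-1/2) * A \<rho>) *\<^sub>R n \<rho>)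
           (\<lambda>\<rho>. len X \<rho> *\<^sub>R (hess lng (X \<rho>) *v \<phi> \<rho>))
       - 1/2 * ip_h J
           (\<lambda>\<rho>. g (X \<rho>) powr (-1/2) * A \<rho> *
                  ((inverse (norm (\<omega> \<rho>)) *\<^sub>R grad lng (X \<rho>)) \<bullet> perp (n \<rho>)))
           (\<lambda>\<rho>. (n \<rho> \<bullet> d_s X \<phi> \<rho>) * len X \<rho>)
       + ip_h J (\<lambda>\<rho>. \<kappa> \<rho> *\<^sub>R perp (Y \<rho>)) (\<lambda>\<rho>. len X \<rho> *\<^sub>R d_s X \<phi> \<rho>))"

definition scheme_ii ::
  "nat \<Rightarrow> (real^2 \<Rightarrow> real) \<Rightarrow> (real \<Rightarrow> real^2) \<Rightarrow> (real \<Rightarrow> real) \<Rightarrow> (real \<Rightarrow> real^2) \<Rightarrow> bool" where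
  "scheme_ii J g X \<kappa> Y \<longleftrightarrow>
    (\<forall>\<phi>\<in>Vh J. ip_h J (\<lambda>\<rho>. g (X \<rho>) powr (-1/2) * A_h J g X \<kappa> \<rho> - Y \<rho> \<bullet> nu_h X \<rho>)
                     (\<lambda>\<rho>. \<phi> \<rho> * len X \<rho>) = 0)"

definition scheme_iii :: "nat \<Rightarrow> (real \<Rightarrow> real^2) \<Rightarrow> (real \<Rightarrow> real) \<Rightarrow> bool" where
  "scheme_iii J X \<kappa> \<longleftrightarrow>
    (\<forall>\<eta>\<in>Vh J. ip_h J (\<lambda>\<rho>. \<kappa> \<rho> *\<^sub>R nu_h X \<rho>) (\<lambda>\<rho>. len X \<rho> *\<^sub>R \<eta> \<rho>)
             + ip (d_s X X) (\<lambda>\<rho>. len X \<rho> *\<^sub>R d_s X \<eta> \<rho>) = 0)"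

text \<open>Time-dependent functions take the time as first argument. The time derivative is taken
  relative to \<open>(0,T]\<close>: it is one-sided at \<open>T\<close> and two-sided before.\<close>

definition d_t :: "real \<Rightarrow> (real \<Rightarrow> real \<Rightarrow> 'a::real_normed_vector) \<Rightarrow> real \<Rightarrow> real \<Rightarrow> 'a" where
  "d_t T u t \<rho> = vector_derivative (\<lambda>s. u s \<rho>) (at t within {0<..T})"

definition solves_scheme ::
  "nat \<Rightarrow> (real^2 \<Rightarrow> real) \<Rightarrow> real \<Rightarrow> real \<Rightarrow> (real \<Rightarrow> real \<Rightarrow> real^2) \<Rightarrow>
   (real \<Rightarrow> real \<Rightarrow> real) \<Rightarrow> (real \<Rightarrow> real \<Rightarrow> real^2) \<Rightarrow> bool" where
  "solves_scheme J g lam T X \<kappa> Y \<longleftrightarrow>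
     X 0 \<in> Vh J \<and>
     (\<forall>t\<in>{0<..T}.
        X t \<in> Vh J \<and> \<kappa> t \<in> Vh J \<and> Y t \<in> Vh J \<and>
        scheme_i J g lam (X t) (d_t T X t) (\<kappa> t) (Y t) \<and>
        scheme_ii J g (X t) (\<kappa> t) (Y t) \<and>
        scheme_iii J (X t) (\<kappa> t))"

end

(* Mass lumping turns every term of the scheme into a sum over the nodes. In nodal form
   omega is the rotated chord between the two neighbouring vertices divided by the sum of the two
   adjacent edge lengths, so n is the rotated unit chord and can be differentiated explicitly.
   Differentiate the nodal energy: the mass, metric, Hessian and normal terms reproduce the terms of
   equation (i) tested with X_t, and what remains is the sum of m_j g^(-1/2) A_j kappa_j'. Equation (ii) tested
   with kappa_t rewrites it with Y, and the time derivative of (iii), tested with the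
   time-independent function Y(t), turns it into the two remaining terms of (i). *)
theory Submission
  imports Defs
begin

text \<open>Three obstacles shape the development. The time derivative of \<open>X\<close> must be
  an admissible test function; this is why elements of \<open>Vh\<close> are rebuilt from fixed hat
  functions, so that only the finitely many nodal coefficients depend on time. The mass-lumped
  product is defined by one-sided limits, so every nodal formula needs continuity of the data at the
  nodes, and for \<open>n_h\<close> this rests on \<open>omega_h\<close> being nonzero there. No
  regularity of \<open>Y\<close> in time is assumed, so only \<open>X\<close> and
  \<open>\<kappa>\<close> may be differentiated in (iii).

  The less familiar terms of (i) come from one fact: a unit vector in the plane can only rotate. For
  unit edges this gives the product of the normal components of Y_s and chi_s; for unit chords it
  gives the term with the rotated normal, whose factor 1/|omega| equals 2 * mass / |chord|. The two
  non-degeneracy assumptions say that edges and chords do not vanish.\<close>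

section \<open>Periodic piecewise affine functions\<close>

text \<open>Index \<open>j\<close> refers to the element \<open>{node J (j - 1)..node J j}\<close>; only \<open>j \<ge> 1\<close> is meaningful.\<close>

definition edge :: "nat \<Rightarrow> (real \<Rightarrow> 'a::real_normed_vector) \<Rightarrow> nat \<Rightarrow> 'a" where
  "edge J u j = u (node J j) - u (node J (j - 1))"

lemma node_0 [simp]: "node J 0 = 0"
  by (simp add: node_def)

lemma node_self [simp]: "J > 0 \<Longrightarrow> node J J = 1"
  by (simp add: node_def)

lemma node_shift: "J > 0 \<Longrightarrow> node J (j + J) = node J j + 1"
  by (simp add: node_def field_simps)

lemma node_Suc: "node J (Suc j) = node J j + 1 / real J"
  by (simp add: node_def add_divide_distrib)

lemma node_pred: "j \<ge> 1 \<Longrightarrow> node J j = node J (j - 1) + 1 / real J"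
  using node_Suc[of J "j - 1"] by simp

lemma node_less: "J > 0 \<Longrightarrow> j \<ge> 1 \<Longrightarrow> node J (j - 1) < node J j"
  using node_pred[of j J] by simp

lemma Vh_periodic: "u \<in> Vh J \<Longrightarrow> u (\<rho> + 1) = u \<rho>"
  by (simp add: Vh_def)

lemma Vh_periodic_nat: "u \<in> Vh J \<Longrightarrow> u (\<rho> + real n) = u \<rho>"
proof (induction n)
  case (Suc n)
  then show ?case using Vh_periodic[of u J "\<rho> + real n"] by (simp add: algebra_simps)
qed simp

lemma Vh_periodic_int:
  assumes "u \<in> Vh J"
  shows "u (\<rho> + of_int k) = u \<rho>"
proof (cases "k \<ge> 0")
  case True
  then show ?thesis using Vh_periodic_nat[OF assms, of \<rho> "nat k"] by simp
next
  case False
  then show ?thesis using Vh_periodic_nat[OF assms, of "\<rho> + of_int k" "nat (-k)"] by simp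
qed

lemma Vh_node_shift: "u \<in> Vh J \<Longrightarrow> J > 0 \<Longrightarrow> u (node J (j + J)) = u (node J j)"
  by (simp add: node_shift Vh_periodic)

lemma Vh_node_0: "u \<in> Vh J \<Longrightarrow> J > 0 \<Longrightarrow> u (node J J) = u (node J 0)"
  using Vh_node_shift[of u J 0] by simp

lemma edge_wrap: "u \<in> Vh J \<Longrightarrow> J > 0 \<Longrightarrow> edge J u (Suc J) = edge J u (Suc 0)"
  using Vh_node_shift[of u J 1] Vh_node_0[of u J] by (simp add: edge_def)

lemma Vh_isCont: "u \<in> Vh J \<Longrightarrow> isCont u \<rho>"
  by (simp add: Vh_def continuous_on_eq_continuous_at)

text \<open>Evaluating at both end points eliminates the anonymous coefficients in
  \<open>Vh\<close>. Elements have length 1/J, hence the slope is \<open>real J\<close> times the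
  increment.\<close>

lemma Vh_affine:
  assumes "u \<in> Vh J" "j \<in> {1..J}" "\<rho> \<in> {node J (j - 1)..node J j}"
  shows "u \<rho> = u (node J (j - 1)) + (real J * (\<rho> - node J (j - 1))) *\<^sub>R edge J u j"
proof -
  obtain a b where ab: "\<And>\<rho>. \<rho> \<in> {node J (j - 1)..node J j} \<Longrightarrow> u \<rho> = a + \<rho> *\<^sub>R b"
    using assms(1,2) unfolding Vh_def by blast
  have J: "J > 0" and j: "j \<ge> 1" using assms(2) by auto
  have lt: "node J (j - 1) < node J j" using node_less[OF J j] .
  have "edge J u j = (node J j - node J (j - 1)) *\<^sub>R b"
    unfolding edge_def using ab[of "node J j"] ab[of "node J (j - 1)"] lt
    by (simp add: algebra_simps)
  also have "\<dots> = (1 / real J) *\<^sub>R b" using node_pred[OF j] by simp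
  finally have "edge J u j = (1 / real J) *\<^sub>R b" .
  then show ?thesis
    using ab[OF assms(3)] ab[of "node J (j - 1)"] lt J by (simp add: algebra_simps)
qed

lemma element_exists:
  assumes "J > 0" "0 \<le> \<rho>" "\<rho> < 1"
  obtains j where "j \<in> {1..J}" "\<rho> \<in> {node J (j - 1)..node J j}"
proof -
  define k where "k = nat \<lfloor>real J * \<rho>\<rfloor>"
  have k: "real k \<le> real J * \<rho>" "real J * \<rho> < real k + 1"
    using assms unfolding k_def by (auto simp: of_nat_nat)
  have "real J * \<rho> < real J" using assms by simp
  then have "k < J" using k by linarith
  then have "Suc k \<in> {1..J}" by auto
  moreover have "\<rho> \<in> {node J (Suc k - 1)..node J (Suc k)}"
    using k assms(1) by (auto simp: node_def field_simps)
  ultimately show ?thesis by (rule that)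
qed

text \<open>Periodicity reduces any argument to its fractional part, which lies in some element,
  where the affine form depends on the two end values only. Node 0 is node \<open>J\<close>, so the
  indices 1 to \<open>J\<close> suffice.\<close>

lemma Vh_eqI:
  fixes u v :: "real \<Rightarrow> 'a::real_normed_vector"
  assumes "J > 0" "u \<in> Vh J" "v \<in> Vh J"
    and nodes: "\<And>j. j \<in> {1..J} \<Longrightarrow> u (node J j) = v (node J j)"
  shows "u = v"
proof
  fix \<rho> :: real
  have nodes': "u (node J j) = v (node J j)" if "j \<le> J" for j
  proof (cases "j = 0")
    case True
    then show ?thesis
      using nodes[of J] Vh_node_0[OF assms(2,1)] Vh_node_0[OF assms(3,1)] assms(1) by auto
  qed (use that nodes in auto)
  obtain j where j: "j \<in> {1..J}" "frac \<rho> \<in> {node J (j - 1)..node J j}"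
    using element_exists[OF assms(1) frac_ge_0 frac_lt_1] by blast
  have pred: "u (node J (j - 1)) = v (node J (j - 1))" and "u (node J j) = v (node J j)"
    using j(1) by (auto intro!: nodes')
  then have "edge J u j = edge J v j" by (simp add: edge_def)
  then have "u (frac \<rho>) = v (frac \<rho>)"
    using Vh_affine[OF assms(2) j] Vh_affine[OF assms(3) j] pred by simp
  moreover have "w (frac \<rho>) = w \<rho>" if "w \<in> Vh J" for w :: "real \<Rightarrow> 'a"
    using Vh_periodic_int[OF that, of "frac \<rho>" "\<lfloor>\<rho>\<rfloor>"] by (simp add: frac_def)
  ultimately show "u \<rho> = v \<rho>" using assms(2,3) by metis
qed

lemma Vh_bounded_linear:
  assumes f: "bounded_linear f" and u: "u \<in> Vh J"
  shows "(\<lambda>\<rho>. f (u \<rho>)) \<in> Vh J"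
  unfolding Vh_def
proof (intro CollectI conjI ballI allI)
  show "continuous_on UNIV (\<lambda>\<rho>. f (u \<rho>))"
    using u by (auto simp: Vh_def intro!: bounded_linear.continuous_on[OF f])
  interpret bounded_linear f by (rule f)
  fix j assume "j \<in> {1..J}"
  then obtain a b where "\<forall>\<rho>\<in>{node J (j - 1)..node J j}. u \<rho> = a + \<rho> *\<^sub>R b"
    using u unfolding Vh_def by blast
  then have "\<forall>\<rho>\<in>{node J (j - 1)..node J j}. f (u \<rho>) = f a + \<rho> *\<^sub>R f b"
    by (simp add: add scaleR)
  then show "\<exists>a b. \<forall>\<rho>\<in>{node J (j - 1)..node J j}. f (u \<rho>) = a + \<rho> *\<^sub>R b" by blast
qed (use u in \<open>auto simp: Vh_def\<close>)

lemma Vh_zero: "(\<lambda>\<rho>. 0) \<in> Vh J"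
  by (auto simp: Vh_def intro!: exI[of _ 0])

lemma Vh_add: "u \<in> Vh J \<Longrightarrow> v \<in> Vh J \<Longrightarrow> (\<lambda>\<rho>. u \<rho> + v \<rho>) \<in> Vh J"
proof -
  assume u: "u \<in> Vh J" and v: "v \<in> Vh J"
  show ?thesis unfolding Vh_def
  proof (intro CollectI conjI ballI allI)
    show "continuous_on UNIV (\<lambda>\<rho>. u \<rho> + v \<rho>)"
      using u v by (auto simp: Vh_def intro!: continuous_intros)
    fix j assume j: "j \<in> {1..J}"
    obtain a b where 1: "\<forall>\<rho>\<in>{node J (j - 1)..node J j}. u \<rho> = a + \<rho> *\<^sub>R b"
      using u j unfolding Vh_def by blast
    obtain c d where 2: "\<forall>\<rho>\<in>{node J (j - 1)..node J j}. v \<rho> = c + \<rho> *\<^sub>R d"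
      using v j unfolding Vh_def by blast
    have "\<forall>\<rho>\<in>{node J (j - 1)..node J j}. u \<rho> + v \<rho> = (a + c) + \<rho> *\<^sub>R (b + d)"
      using 1 2 by (simp add: algebra_simps)
    then show "\<exists>a b. \<forall>\<rho>\<in>{node J (j - 1)..node J j}. u \<rho> + v \<rho> = a + \<rho> *\<^sub>R b" by blast
  qed (use u v in \<open>auto simp: Vh_def\<close>)
qed

lemma Vh_sum: "(\<And>k. k \<in> K \<Longrightarrow> u k \<in> Vh J) \<Longrightarrow> (\<lambda>\<rho>. \<Sum>k\<in>K. u k \<rho>) \<in> Vh J"
  by (induction K rule: infinite_finite_induct) (auto intro: Vh_zero Vh_add)

text \<open>Writing the periodic triangle wave with \<open>arccos\<close> and \<open>cos\<close> makes the continuity and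
  1-periodicity of the hat functions immediate.\<close>

definition tri :: "real \<Rightarrow> real" where
  "tri x = arccos (cos (2 * pi * x)) / (2 * pi)"

text \<open>\<open>tri\<close> is the distance to the nearest integer, so this is the nodal basis
  function of node \<open>k\<close>: the neighbouring nodes have distance 1/J, where the hat reaches
  0.\<close>

definition hat :: "nat \<Rightarrow> nat \<Rightarrow> real \<Rightarrow> real" where
  "hat J k \<rho> = max 0 (1 - real J * tri (\<rho> - node J k))"

lemma tri_periodic: "tri (x + 1) = tri x"
proof -
  have "cos (2 * pi * (x + 1)) = cos (2 * pi * x + 2 * pi)" by (simp add: algebra_simps)
  then show ?thesis unfolding tri_def by (metis cos_periodic)
qed

text \<open>\<open>arccos\<close> inverts \<open>cos\<close> only on [0, pi], that is for x up to
  1/2. Beyond that, the reflection of x to 1 - x preserves the cosine and returns to this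
  range.\<close>

lemma tri_eq:
  assumes "0 \<le> x" "x \<le> 1"
  shows "tri x = min x (1 - x)"
proof (cases "x \<le> 1/2")
  case True
  then have "arccos (cos (2 * pi * x)) = 2 * pi * x"
    using assms by (intro arccos_cos) auto
  then show ?thesis using True by (simp add: tri_def)
next
  case False
  have "cos (2 * pi * x) = cos (2 * pi * (1 - x))"
    using cos_2pi_minus[of "2 * pi * x"] by (simp add: algebra_simps)
  moreover have "arccos (cos (2 * pi * (1 - x))) = 2 * pi * (1 - x)"
    using assms False by (intro arccos_cos) auto
  ultimately show ?thesis using False by (simp add: tri_def)
qed

lemma continuous_on_tri: "continuous_on UNIV tri"
  unfolding tri_def by (intro continuous_intros) auto

lemma hat_continuous: "continuous_on UNIV (hat J k)"
  unfolding hat_def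
  by (intro continuous_intros continuous_on_compose2[OF continuous_on_tri]) auto

text \<open>The kink of \<open>tri\<close> at distance 1/2 does no harm for
  \<open>J \<ge> 2\<close>, because 1 - J/2 \<le> 0 and the hat is already cut off there. All other
  kinks are nodes.\<close>

lemma hat_in_Vh:
  assumes J: "J \<ge> 2" and k: "k \<in> {1..J}"
  shows "hat J k \<in> Vh J"
  unfolding Vh_def
proof (intro CollectI conjI ballI allI)
  show "hat J k (\<rho> + 1) = hat J k \<rho>" for \<rho>
    using tri_periodic[of "\<rho> - node J k"] by (simp add: hat_def algebra_simps)
  show "continuous_on UNIV (hat J k)" by (rule hat_continuous)
  fix i assume i: "i \<in> {1..J}"
  \<comment> \<open>The shift \<open>c\<close>, which is 0 or 1, moves the offset from node
    \<open>k\<close> into [0,1]; \<open>m\<close> counts the elements from node \<open>k\<close>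
    forward to the left end of element \<open>i\<close>, cyclically.\<close>
  have piece: "\<exists>a b. \<forall>\<rho>\<in>{node J (i - 1)..node J i}. hat J k \<rho> = a + \<rho> *\<^sub>R b"
    if c: "\<And>\<rho>. tri (\<rho> - node J k) = tri (\<rho> - node J k + c)"
      and m: "real i - 1 - real k + real J * c = real m" "m < J" for c m
  proof -
    have Jy: "real m \<le> real J * (\<rho> - node J k + c)" "real J * (\<rho> - node J k + c) \<le> real m + 1"
      if "\<rho> \<in> {node J (i - 1)..node J i}" for \<rho>
    proof -
      have "real i - 1 \<le> real J * \<rho>" "real J * \<rho> \<le> real i"
        using that i J by (auto simp: node_def field_simps of_nat_diff)
      moreover have "real J * (\<rho> - node J k + c) = real J * \<rho> - real k + real J * c"
        using J by (simp add: node_def algebra_simps)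
      ultimately show "real m \<le> real J * (\<rho> - node J k + c)"
          "real J * (\<rho> - node J k + c) \<le> real m + 1"
        using m(1) by linarith+
    qed
    have y01: "0 \<le> \<rho> - node J k + c" "\<rho> - node J k + c \<le> 1"
      if "\<rho> \<in> {node J (i - 1)..node J i}" for \<rho>
    proof -
      have "0 \<le> real J * (\<rho> - node J k + c)" "real J * (\<rho> - node J k + c) \<le> real J * 1"
        using Jy[OF that] m(2) by linarith+
      then show "0 \<le> \<rho> - node J k + c" "\<rho> - node J k + c \<le> 1"
        using J by (auto simp: zero_le_mult_iff)
    qed
    have hat: "hat J k \<rho> = max 0 (1 - min (real J * (\<rho> - node J k + c)) (real J - real J * (\<rho> - node J k + c)))"
      if "\<rho> \<in> {node J (i - 1)..node J i}" for \<rho>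
    proof -
      have "real J * min y (1 - y) = min (real J * y) (real J - real J * y)" for y
        using J by (simp add: min_mult_distrib_left right_diff_distrib)
      then show ?thesis
        unfolding hat_def c[of \<rho>] tri_eq[OF y01[OF that]] by simp
    qed
    \<comment> \<open>The element to the right of node \<open>k\<close> (descending flank), the one
      to its left (ascending flank), and those outside the support.\<close>
    consider "m = 0" | "m = J - 1" | "1 \<le> m" "m + 2 \<le> J" using m(2) by linarith
    then show ?thesis
    proof cases
      case 1
      have "hat J k \<rho> = (1 + real J * node J k - real J * c) + \<rho> *\<^sub>R (- real J)"
        if "\<rho> \<in> {node J (i - 1)..node J i}" for \<rho>
        using hat[OF that] Jy[OF that] 1 J by (auto simp: min_def max_def algebra_simps)
      then show ?thesis by blast
    next
      case 2
      have "hat J k \<rho> = (1 - real J - real J * node J k + real J * c) + \<rho> *\<^sub>R real J"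
        if "\<rho> \<in> {node J (i - 1)..node J i}" for \<rho>
        using hat[OF that] Jy[OF that] 2 J by (auto simp: min_def max_def algebra_simps of_nat_diff)
      then show ?thesis by blast
    next
      case 3
      then have "real m + 2 \<le> real J" by linarith
      then have "hat J k \<rho> = 0 + \<rho> *\<^sub>R 0"
        if "\<rho> \<in> {node J (i - 1)..node J i}" for \<rho>
        using hat[OF that] Jy[OF that] 3 by (auto simp: min_def max_def)
      then show ?thesis by blast
    qed
  qed
  show "\<exists>a b. \<forall>\<rho>\<in>{node J (i - 1)..node J i}. hat J k \<rho> = a + \<rho> *\<^sub>R b"
  proof (cases "k < i")
    case True
    then show ?thesis using i k by (intro piece[of 0 "i - 1 - k"]) (auto simp: of_nat_diff)
  next
    case False
    then show ?thesis using i k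
      by (intro piece[of 1 "J + i - 1 - k"]) (auto simp: of_nat_diff tri_periodic)
  qed
qed

lemma hat_node:
  assumes J: "J \<ge> 2" and k: "k \<in> {1..J}" and j: "j \<in> {1..J}"
  shows "hat J k (node J j) = (if j = k then 1 else 0)"
proof -
  have val: "hat J k (node J j) = max 0 (1 - min (real m) (real J - real m))"
    if c: "tri (node J j - node J k) = tri (real m / real J)" and "m < J" for m
  proof -
    have "real J * min y (1 - y) = min (real J * y) (real J - real J * y)" for y
      using J by (simp add: min_mult_distrib_left right_diff_distrib)
    then show ?thesis
      unfolding hat_def c using J that(2) by (subst tri_eq) auto
  qed
  consider "j = k" | "k < j" | "j < k" by linarith
  then show ?thesis
  proof cases
    case 1
    then show ?thesis using val[of 0] J by simp
  next
    case 2
    have eq: "node J j - node J k = real (j - k) / real J"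
      using 2 by (simp add: node_def of_nat_diff diff_divide_distrib)
    have "hat J k (node J j) = max 0 (1 - min (real (j - k)) (real J - real (j - k)))"
      using 2 j k by (intro val) (auto simp: eq)
    then show ?thesis using 2 j k by (auto simp: min_def of_nat_diff max_def)
  next
    case 3
    have "node J j - node J k + 1 = real (J + j - k) / real J"
      using 3 j k by (simp add: node_def of_nat_diff field_simps)
    then have eq: "tri (node J j - node J k) = tri (real (J + j - k) / real J)"
      by (metis tri_periodic)
    have "hat J k (node J j) = max 0 (1 - min (real (J + j - k)) (real J - real (J + j - k)))"
      using 3 j k by (intro val eq) auto
    then show ?thesis using 3 j k by (auto simp: min_def of_nat_diff max_def)
  qed
qed

section \<open>Nodal interpolation and time derivatives in \<open>Vh\<close>\<close>

definition interp :: "nat \<Rightarrow> (nat \<Rightarrow> 'a::real_normed_vector) \<Rightarrow> real \<Rightarrow> 'a" where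
  "interp J c \<rho> = (\<Sum>k=1..J. hat J k \<rho> *\<^sub>R c k)"

lemma interp_in_Vh: "J \<ge> 2 \<Longrightarrow> interp J c \<in> Vh J"
  unfolding interp_def by (intro Vh_sum Vh_bounded_linear[OF bounded_linear_scaleR_left] hat_in_Vh)

lemma interp_node: "J \<ge> 2 \<Longrightarrow> j \<in> {1..J} \<Longrightarrow> interp J c (node J j) = c j"
  unfolding interp_def by (simp add: hat_node if_distrib if_distribR cong: if_cong)

lemma interp_Vh:
  assumes "J \<ge> 2" "u \<in> Vh J"
  shows "interp J (\<lambda>k. u (node J k)) = u"
  using assms by (intro Vh_eqI[of J]) (auto simp: interp_in_Vh interp_node)

text \<open>Every such \<open>t\<close> is approached from the left within the interval, also
  \<open>t = T\<close>. This makes derivatives relative to (0,T] unique, so that \<open>d_t\<close>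
  can be identified and derivatives can be compared.\<close>

lemma at_within_Ioc_nontrivial:
  fixes t T :: real
  assumes "0 < t" "t \<le> T"
  shows "at t within {0<..T} \<noteq> bot"
proof -
  have "t islimpt {0<..T}"
  proof (rule islimpt_subset)
    show "t islimpt {0<..<t}" using assms by (simp add: islimpt_greaterThanLessThan2)
  qed (use assms in auto)
  then show ?thesis by (simp add: trivial_limit_within)
qed

lemma d_t_works:
  assumes "t \<in> {0<..T}" "(\<lambda>s. u s \<rho>) differentiable (at t within {0<..T})"
  shows "((\<lambda>s. u s \<rho>) has_vector_derivative d_t T u t \<rho>) (at t within {0<..T})"
  using assms(2) unfolding d_t_def by (simp add: vector_derivative_works)

lemma d_t_eqI:
  assumes "t \<in> {0<..T}" "((\<lambda>s. u s \<rho>) has_vector_derivative v) (at t within {0<..T})"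
  shows "d_t T u t \<rho> = v"
  unfolding d_t_def using assms at_within_Ioc_nontrivial[of t T]
  by (intro vector_derivative_within) auto

text \<open>Makes the time derivatives of \<open>X\<close> and \<open>\<kappa>\<close> admissible as
  test functions. The function is a finite combination of fixed hats with time-dependent nodal
  coefficients, and differentiation acts on the coefficients only.\<close>

lemma d_t_in_Vh:
  assumes J: "J \<ge> 2" and t: "t \<in> {0<..T}"
    and u: "\<And>s. s \<in> {0<..T} \<Longrightarrow> u s \<in> Vh J"
    and diff: "\<And>\<rho>. (\<lambda>s. u s \<rho>) differentiable (at t within {0<..T})"
  shows "d_t T u t \<in> Vh J"
proof -
  have "d_t T u t \<rho> = interp J (\<lambda>k. d_t T u t (node J k)) \<rho>" for \<rho>
  proof (rule d_t_eqI[OF t])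
    have "((\<lambda>s. interp J (\<lambda>k. u s (node J k)) \<rho>) has_vector_derivative
        interp J (\<lambda>k. d_t T u t (node J k)) \<rho>) (at t within {0<..T})"
      unfolding interp_def
      by (intro has_vector_derivative_sum
          bounded_linear.has_vector_derivative[OF bounded_linear_scaleR_right] d_t_works t diff)
    moreover have "u s \<rho> = interp J (\<lambda>k. u s (node J k)) \<rho>" if "s \<in> {0<..T}" for s
      by (simp only: interp_Vh[OF J u[OF that]])
    ultimately show "((\<lambda>s. u s \<rho>) has_vector_derivative
        interp J (\<lambda>k. d_t T u t (node J k)) \<rho>) (at t within {0<..T})"
      by (rule has_vector_derivative_transform[OF t, rotated])
  qed
  then have "d_t T u t = interp J (\<lambda>k. d_t T u t (node J k))" by (rule ext)
  also have "\<dots> \<in> Vh J" by (rule interp_in_Vh[OF J])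
  finally show ?thesis .
qed

lemma Vh_1: "u \<in> Vh J \<Longrightarrow> u 1 = u 0"
  using Vh_periodic[of u J 0] by simp

section \<open>Rotation and unit vectors in the plane\<close>

lemma perp_component [simp]: "perp a $ 1 = a $ 2" "perp a $ 2 = - (a $ 1)"
  by (simp_all add: perp_def)

lemma inner_real2: "a \<bullet> b = a $ 1 * b $ 1 + a $ 2 * b $ 2" for a b :: "real^2"
  by (simp add: inner_vec_def sum_2)

lemma vec2_eq_iff: "a = b \<longleftrightarrow> a $ 1 = b $ 1 \<and> a $ 2 = b $ 2" for a b :: "real^2"
  by (simp add: vec_eq_iff forall_2)

lemma linear_perp: "linear perp"
  by (rule linearI) (simp_all add: vec2_eq_iff)

lemma bounded_linear_perp: "bounded_linear perp"
  using linear_perp by (simp add: linear_linear)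

lemmas perp_add = linear_add[OF linear_perp]
  and perp_minus = linear_neg[OF linear_perp]
  and perp_scaleR = linear_cmul[OF linear_perp]

lemma perp_inner_perp [simp]: "perp a \<bullet> perp b = a \<bullet> b"
  by (simp add: inner_real2)

lemma norm_perp [simp]: "norm (perp a) = norm a"
  by (simp add: norm_eq_sqrt_inner)

lemma perp_inner_left: "perp a \<bullet> b = - (a \<bullet> perp b)"
  by (simp add: inner_real2)

lemma perp_eq_0_iff [simp]: "perp a = 0 \<longleftrightarrow> a = 0"
  by (metis norm_eq_zero norm_perp)

lemma sgn_perp: "sgn (perp a) = perp (sgn a)"
  by (simp add: sgn_div_norm perp_scaleR)

lemma isCont_perp [continuous_intros]: "isCont f x \<Longrightarrow> isCont (\<lambda>x. perp (f x)) x"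
  by (rule bounded_linear.isCont[OF bounded_linear_perp])

text \<open>\<open>a\<close> and \<open>perp a\<close> form an orthonormal basis of the plane. In
  coordinates, the identity is \<open>w\<close> multiplied by |a|^2 = 1.\<close>

lemma unit_decomposition:
  fixes a w :: "real^2"
  assumes "norm a = 1"
  shows "w - (a \<bullet> w) *\<^sub>R a = (perp a \<bullet> w) *\<^sub>R perp a"
proof -
  have "(a $ 1)\<^sup>2 + (a $ 2)\<^sup>2 = 1"
    using assms by (simp add: norm_eq_sqrt_inner inner_real2 power2_eq_square)
  then have "w $ i = ((a $ 1)\<^sup>2 + (a $ 2)\<^sup>2) * w $ i" for i by simp
  from this[of 1] this[of 2] show ?thesis unfolding vec2_eq_iff inner_real2
    by (simp add: algebra_simps power2_eq_square)
qed

text \<open>The quotient rule subtracts from \<open>d'\<close> its component along \<open>d\<close>;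
  by \<open>unit_decomposition\<close> what is left is the component along \<open>perp\<close>. Used
  for both unit edges and unit chords.\<close>

lemma has_vector_derivative_sgn:
  fixes d :: "real \<Rightarrow> real^2"
  assumes d: "(d has_vector_derivative d') (at t within S)" and nz: "d t \<noteq> 0"
  shows "((\<lambda>s. sgn (d s)) has_vector_derivative
     ((perp (sgn (d t)) \<bullet> d') / norm (d t)) *\<^sub>R perp (sgn (d t))) (at t within S)"
proof -
  have D: "(d has_derivative (\<lambda>h. h *\<^sub>R d')) (at t within S)"
    using d by (simp add: has_vector_derivative_def)
  have N: "((\<lambda>s. norm (d s)) has_derivative (\<lambda>h. (h *\<^sub>R d') \<bullet> sgn (d t))) (at t within S)"
    using has_derivative_compose[OF D, of norm "\<lambda>x. x \<bullet> sgn (d t)"] GDERIV_norm[OF nz]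
    by (simp add: gderiv_def)
  have "((\<lambda>s. sgn (d s)) has_derivative
     (\<lambda>h. (h *\<^sub>R d') /\<^sub>R norm (d t) - ((h *\<^sub>R d') \<bullet> sgn (d t)) *\<^sub>R (sgn (d t) /\<^sub>R norm (d t)))) (at t within S)"
    unfolding sgn_div_norm
    by (rule derivative_eq_intros D N | simp add: nz sgn_div_norm power2_eq_square mult_ac)+
  moreover have "(h *\<^sub>R d') /\<^sub>R norm (d t) - ((h *\<^sub>R d') \<bullet> sgn (d t)) *\<^sub>R (sgn (d t) /\<^sub>R norm (d t))
     = h *\<^sub>R (((perp (sgn (d t)) \<bullet> d') / norm (d t)) *\<^sub>R perp (sgn (d t)))" for h
  proof -
    have "norm (sgn (d t)) = 1" using nz by (simp add: norm_sgn)
    from unit_decomposition[OF this, of d'] have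
      "(perp (sgn (d t)) \<bullet> d') *\<^sub>R perp (sgn (d t)) = d' - (sgn (d t) \<bullet> d') *\<^sub>R sgn (d t)" ..
    have "h *\<^sub>R (((perp (sgn (d t)) \<bullet> d') / norm (d t)) *\<^sub>R perp (sgn (d t)))
       = (h / norm (d t)) *\<^sub>R ((perp (sgn (d t)) \<bullet> d') *\<^sub>R perp (sgn (d t)))"
      by simp
    also note \<open>(perp (sgn (d t)) \<bullet> d') *\<^sub>R perp (sgn (d t)) = _\<close>
    finally show ?thesis by (simp add: algebra_simps divide_inverse inner_commute)
  qed
  ultimately show ?thesis unfolding has_vector_derivative_def by simp
qed

lemma has_real_derivative_norm:
  assumes d: "(d has_vector_derivative d') (at t within S)" and nz: "d t \<noteq> (0::'a::real_inner)"
  shows "((\<lambda>s. norm (d s)) has_real_derivative sgn (d t) \<bullet> d') (at t within S)"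
proof -
  have D: "(d has_derivative (\<lambda>h. h *\<^sub>R d')) (at t within S)"
    using d by (simp add: has_vector_derivative_def)
  have N: "((\<lambda>s. norm (d s)) has_derivative (\<lambda>h. (h *\<^sub>R d') \<bullet> sgn (d t))) (at t within S)"
    using has_derivative_compose[OF D, of norm "\<lambda>x. x \<bullet> sgn (d t)"] GDERIV_norm[OF nz]
    by (simp add: gderiv_def)
  then show ?thesis
    by (simp add: has_field_derivative_def inner_commute mult_commute_abs)
qed

section \<open>Nodal form of the discrete inner products\<close>

text \<open>The auxiliary identity carries the boundary terms \<open>f 0\<close> and
  \<open>f n\<close> through the induction; they cancel at \<open>n = J\<close>.\<close>

lemma sum_cyclic:
  fixes f :: "nat \<Rightarrow> 'a::ab_group_add"
  assumes "f 0 = f J"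
  shows "(\<Sum>j=1..J. f (j - 1)) = (\<Sum>j=1..J. f j)"
proof -
  have "(\<Sum>j=1..n. f (j - 1)) + f n = f 0 + (\<Sum>j=1..n. f j)" for n
    by (induction n) (simp_all add: algebra_simps)
  from this[of J] show ?thesis using assms by simp
qed

text \<open>Continuity is required at the nodes only: \<open>\<omega>\<^sup>h\<close> may vanish inside an
  element, and there \<open>n\<^sup>h\<close> jumps.\<close>

lemma ip_h_eval:
  assumes J: "J > 0"
    and eq: "\<And>j \<rho>. j \<in> {1..J} \<Longrightarrow> \<rho> \<in> {node J (j - 1)<..<node J j} \<Longrightarrow> u \<rho> \<bullet> v \<rho> = F j \<rho>"
    and cont: "\<And>j. j \<in> {1..J} \<Longrightarrow> isCont (F j) (node J j)"
      "\<And>j. j \<in> {1..J} \<Longrightarrow> isCont (F j) (node J (j - 1))"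
  shows "ip_h J u v = 1/2 * (1 / real J) * (\<Sum>j=1..J. F j (node J j) + F j (node J (j - 1)))"
  unfolding ip_h_def
proof (intro arg_cong2[of _ _ _ _ "(*)"] refl sum.cong arg_cong2[of _ _ _ _ "(+)"])
  fix j assume j: "j \<in> {1..J}"
  then have lt: "node J (j - 1) < node J j" using J by (intro node_less) auto
  \<comment> \<open>\<open>F j\<close> is continuous across the node, so its value there is the
    one-sided limit. The integrand has to agree with it inside the element only.\<close>
  have "(F j \<longlongrightarrow> F j (node J j)) (at_left (node J j))"
    using cont(1)[OF j] by (auto simp: isCont_def intro: tendsto_within_subset)
  moreover have "\<forall>\<^sub>F \<rho> in at_left (node J j). F j \<rho> = u \<rho> \<bullet> v \<rho>"
    using eventually_at_left_real[OF lt] by eventually_elim (use eq[OF j] in auto)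
  ultimately have "((\<lambda>\<rho>. u \<rho> \<bullet> v \<rho>) \<longlongrightarrow> F j (node J j)) (at_left (node J j))"
    by (rule Lim_transform_eventually)
  then show "Lim (at_left (node J j)) (\<lambda>\<rho>. u \<rho> \<bullet> v \<rho>) = F j (node J j)"
    by (intro tendsto_Lim) auto
  have "(F j \<longlongrightarrow> F j (node J (j - 1))) (at_right (node J (j - 1)))"
    using cont(2)[OF j] by (auto simp: isCont_def intro: tendsto_within_subset)
  moreover have "\<forall>\<^sub>F \<rho> in at_right (node J (j - 1)). F j \<rho> = u \<rho> \<bullet> v \<rho>"
    using eventually_at_right_real[OF lt] by eventually_elim (use eq[OF j] in auto)
  ultimately have "((\<lambda>\<rho>. u \<rho> \<bullet> v \<rho>) \<longlongrightarrow> F j (node J (j - 1))) (at_right (node J (j - 1)))"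
    by (rule Lim_transform_eventually)
  then show "Lim (at_right (node J (j - 1))) (\<lambda>\<rho>. u \<rho> \<bullet> v \<rho>) = F j (node J (j - 1))"
    by (intro tendsto_Lim) auto
qed

text \<open>Each element contributes its constant \<open>c j\<close> at both ends; collected by
  node, node \<open>j\<close> receives \<open>c j\<close> from the left and \<open>c (Suc j)\<close>
  from the right. The factor \<open>real J\<close>, which comes from |X_rho|, cancels h. The values
  of \<open>N\<close> lie in an arbitrary inner product space, so scalars, vectors and pairs are all
  covered.\<close>

lemma ip_h_lumped:
  fixes N :: "real \<Rightarrow> 'b::real_inner"
  assumes J: "J > 0"
    and eq: "\<And>j \<rho>. j \<in> {1..J} \<Longrightarrow> \<rho> \<in> {node J (j - 1)<..<node J j} \<Longrightarrow>
      u \<rho> \<bullet> v \<rho> = real J * (N \<rho> \<bullet> c j)"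
    and cont: "\<And>j. j \<le> J \<Longrightarrow> isCont N (node J j)"
    and per: "N 1 = N 0" "c (Suc J) = c 1"
  shows "ip_h J u v = (\<Sum>j=1..J. N (node J j) \<bullet> ((1/2) *\<^sub>R (c j + c (Suc j))))"
proof -
  have "ip_h J u v = 1/2 * (1 / real J) *
      (\<Sum>j=1..J. real J * (N (node J j) \<bullet> c j) + real J * (N (node J (j - 1)) \<bullet> c j))"
    by (rule ip_h_eval[OF J eq]) (auto intro!: continuous_intros cont)
  also have "\<dots> = 1/2 * ((\<Sum>j=1..J. N (node J j) \<bullet> c j) + (\<Sum>j=1..J. N (node J (j - 1)) \<bullet> c j))"
    using J by (simp add: sum.distrib flip: sum_distrib_left distrib_left)
  also have "(\<Sum>j=1..J. N (node J (j - 1)) \<bullet> c j) = (\<Sum>j=1..J. N (node J (j - 1)) \<bullet> c (Suc (j - 1)))"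
    by (intro sum.cong) auto
  also have "\<dots> = (\<Sum>j=1..J. N (node J j) \<bullet> c (Suc j))"
    using J per by (intro sum_cyclic[of "\<lambda>j. N (node J j) \<bullet> c (Suc j)"]) simp
  finally show ?thesis
    by (simp add: inner_add_right sum.distrib sum_distrib_left algebra_simps)
qed

text \<open>The product without mass lumping is only applied to elementwise constants. Their values
  at the nodes are arbitrary, which the spike rule ignores, and the element length 1/J cancels
  \<open>real J\<close>.\<close>

lemma ip_piecewise:
  assumes J: "J > 0"
    and eq: "\<And>j \<rho>. j \<in> {1..J} \<Longrightarrow> \<rho> \<in> {node J (j - 1)<..<node J j} \<Longrightarrow> u \<rho> \<bullet> v \<rho> = real J * c j"
  shows "ip u v = (\<Sum>j=1..J. c j)"
proof -
  have "((\<lambda>\<rho>. u \<rho> \<bullet> v \<rho>) has_integral (\<Sum>j=1..n. c j)) {0..node J n}" if "n \<le> J" for n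
    using that
  proof (induction n)
    case 0
    then show ?case using has_integral_refl(2)[of _ "0::real"] by simp
  next
    case (Suc n)
    have lt: "node J n < node J (Suc n)" using node_less[OF J, of "Suc n"] by simp
    have cst: "(node J (Suc n) - node J n) *\<^sub>R (real J * c (Suc n)) = c (Suc n)"
      using J by (simp add: node_Suc)
    have "((\<lambda>\<rho>. real J * c (Suc n)) has_integral c (Suc n)) (cbox (node J n) (node J (Suc n)))"
      using has_integral_const_real[of "real J * c (Suc n)" "node J n" "node J (Suc n)"] lt
      by (simp only: cst cbox_interval content_real less_imp_le)
    then have "((\<lambda>\<rho>. u \<rho> \<bullet> v \<rho>) has_integral c (Suc n)) (cbox (node J n) (node J (Suc n)))"
      by (rule has_integral_spike_interior) (use eq[of "Suc n"] Suc.prems in auto)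
    then have "((\<lambda>\<rho>. u \<rho> \<bullet> v \<rho>) has_integral c (Suc n)) {node J n..node J (Suc n)}" by simp
    moreover have "0 \<le> node J n" by (simp add: node_def)
    ultimately show ?case
      using has_integral_combine[of 0 "node J n" "node J (Suc n)"] Suc lt by simp
  qed
  from this[of J] show ?thesis using J by (simp add: ip_def integral_unique)
qed

text \<open>The sum telescopes to X at node j+1 minus X at node j-1, so the second non-degeneracy
  assumption is that chords do not vanish.\<close>

definition chord :: "nat \<Rightarrow> (real \<Rightarrow> real^2) \<Rightarrow> nat \<Rightarrow> real^2" where
  "chord J X j = edge J X j + edge J X (Suc j)"

text \<open>The weight that node \<open>j\<close> receives in the lumped product with |X_rho|: h/2
  times the two adjacent values \<open>real J * norm (edge ..)\<close>.\<close>

definition mass :: "nat \<Rightarrow> (real \<Rightarrow> real^2) \<Rightarrow> nat \<Rightarrow> real" where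
  "mass J X j = (norm (edge J X j) + norm (edge J X (Suc j))) / 2"

context
  fixes J :: nat and X :: "real \<Rightarrow> real^2"
  assumes J: "J > 0" and X: "X \<in> Vh J"
begin

lemma d_rho_element:
  fixes u :: "real \<Rightarrow> 'a::real_normed_vector"
  assumes u: "u \<in> Vh J" and j: "j \<in> {1..J}" and \<rho>: "\<rho> \<in> {node J (j - 1)<..<node J j}"
  shows "d_rho u \<rho> = real J *\<^sub>R edge J u j"
  unfolding d_rho_def
proof (rule vector_derivative_at)
  let ?w = "\<lambda>\<rho>. u (node J (j - 1)) + (real J * (\<rho> - node J (j - 1))) *\<^sub>R edge J u j"
  have "(?w has_vector_derivative real J *\<^sub>R edge J u j) (at \<rho>)"
    by (auto intro!: derivative_eq_intros simp: has_vector_derivative_def)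
  moreover have "?w x = u x" if "x \<in> {node J (j - 1)<..<node J j}" for x
    by (rule Vh_affine[OF u j, symmetric]) (use that in auto)
  ultimately show "(u has_vector_derivative real J *\<^sub>R edge J u j) (at \<rho>)"
    by (rule has_vector_derivative_transform_within_open[OF _ open_greaterThanLessThan \<rho>])
qed

context
  fixes j \<rho> assumes j: "j \<in> {1..J}" and \<rho>: "\<rho> \<in> {node J (j - 1)<..<node J j}"
begin

lemma len_element: "len X \<rho> = real J * norm (edge J X j)"
  by (simp add: len_def d_rho_element[OF X j \<rho>])

lemma d_s_element:
  fixes u :: "real \<Rightarrow> 'a::real_normed_vector"
  shows "u \<in> Vh J \<Longrightarrow> d_s X u \<rho> = inverse (norm (edge J X j)) *\<^sub>R edge J u j"
  using J by (simp add: d_s_def len_element d_rho_element[OF _ j \<rho>])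

lemma tau_element: "tau_h X \<rho> = sgn (edge J X j)"
  by (simp add: tau_h_def d_s_element[OF X] sgn_div_norm)

lemma nu_element: "nu_h X \<rho> = - perp (sgn (edge J X j))"
  by (simp add: nu_h_def tau_element)

end

lemma ip_h_len:
  fixes N :: "real \<Rightarrow> real"
  assumes eq: "\<And>\<rho>. u \<rho> \<bullet> v \<rho> = N \<rho> * len X \<rho>"
    and cont: "\<And>j. j \<le> J \<Longrightarrow> isCont N (node J j)" and per: "N 1 = N 0"
  shows "ip_h J u v = (\<Sum>j=1..J. mass J X j * N (node J j))"
proof -
  have "ip_h J u v = (\<Sum>j=1..J. N (node J j) \<bullet>
      ((1/2) *\<^sub>R (norm (edge J X j) + norm (edge J X (Suc j)))))"
    by (rule ip_h_lumped[OF J _ cont per])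
      (auto simp: eq len_element edge_wrap[OF X J])
  then show ?thesis by (simp add: mass_def mult.commute)
qed

text \<open>The factor |X_rho| cancels the normalisation of the element normals. What remains are
  the rotated edges themselves, and two neighbouring ones add up to the rotated chord.\<close>

lemma ip_h_nu:
  assumes w: "w \<in> Vh J" and nz: "\<And>j. j \<in> {1..J} \<Longrightarrow> edge J X j \<noteq> 0"
  shows "ip_h J (nu_h X) (\<lambda>\<rho>. len X \<rho> *\<^sub>R w \<rho>) = (\<Sum>j=1..J. w (node J j) \<bullet> (- (1/2) *\<^sub>R perp (chord J X j)))"
proof -
  have "ip_h J (nu_h X) (\<lambda>\<rho>. len X \<rho> *\<^sub>R w \<rho>) =
     (\<Sum>j=1..J. w (node J j) \<bullet> ((1/2) *\<^sub>R (- perp (edge J X j) + - perp (edge J X (Suc j)))))"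
  proof (rule ip_h_lumped[OF J])
    fix j \<rho> assume j: "j \<in> {1..J}" "\<rho> \<in> {node J (j - 1)<..<node J j}"
    show "nu_h X \<rho> \<bullet> len X \<rho> *\<^sub>R w \<rho> = real J * (w \<rho> \<bullet> - perp (edge J X j))"
      using nz[OF j(1)]
      by (simp add: nu_element[OF j] len_element[OF j] sgn_div_norm perp_scaleR inner_commute)
  qed (use w J X in \<open>auto simp: Vh_1 edge_wrap intro: Vh_isCont\<close>)
  moreover have "(1/2) *\<^sub>R (- perp (edge J X j) + - perp (edge J X (Suc j))) =
      - (1/2) *\<^sub>R perp (chord J X j)" for j
    by (simp add: chord_def perp_add scaleR_add_right scaleR_diff_right)
  ultimately show ?thesis by (simp only:)
qed

end

text \<open>\<open>omega_h\<close> is a definite description, so existence and uniqueness come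
  first. The lumped form on the left is diagonal in the nodal values with positive weights
  \<open>mass\<close>, hence the solution can be read off node by node.\<close>

lemma
  assumes J: "J \<ge> 2" and X: "X \<in> Vh J" and nz: "\<And>j. j \<in> {1..J} \<Longrightarrow> edge J X j \<noteq> 0"
  shows omega_h_in_Vh: "omega_h J X \<in> Vh J"
    and omega_h_node: "j \<in> {1..J} \<Longrightarrow> omega_h J X (node J j) = (- 1 / (2 * mass J X j)) *\<^sub>R perp (chord J X j)"
proof -
  have J0: "J > 0" using J by simp
  define w where "w = interp J (\<lambda>j. (- 1 / (2 * mass J X j)) *\<^sub>R perp (chord J X j))"
  have w: "w \<in> Vh J" unfolding w_def using J by (rule interp_in_Vh)
  have w_node: "w (node J j) = (- 1 / (2 * mass J X j)) *\<^sub>R perp (chord J X j)" if "j \<in> {1..J}" for j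
    unfolding w_def using J that by (rule interp_node)
  have mass: "mass J X j > 0" if "j \<in> {1..J}" for j
    using nz[OF that] unfolding mass_def by (simp add: add_pos_nonneg)
  then have mass_nz: "mass J X j \<noteq> 0" if "j \<in> {1..J}" for j
    using that by (metis less_irrefl)
  have lhs: "ip_h J z (\<lambda>\<rho>. len X \<rho> *\<^sub>R \<phi> \<rho>) = (\<Sum>j=1..J. mass J X j * (z (node J j) \<bullet> \<phi> (node J j)))"
    if "z \<in> Vh J" "\<phi> \<in> Vh J" for z \<phi> :: "real \<Rightarrow> real^2"
    by (rule ip_h_len[OF J0 X])
      (use that in \<open>auto simp: Vh_1 intro!: continuous_intros intro: Vh_isCont\<close>)
  have rhs: "ip_h J (nu_h X) (\<lambda>\<rho>. len X \<rho> *\<^sub>R \<phi> \<rho>) =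
      (\<Sum>j=1..J. \<phi> (node J j) \<bullet> (- (1/2) *\<^sub>R perp (chord J X j)))" if "\<phi> \<in> Vh J" for \<phi>
    using nz by (rule ip_h_nu[OF J0 X that])
  have w_eq: "ip_h J w (\<lambda>\<rho>. len X \<rho> *\<^sub>R \<phi> \<rho>) = ip_h J (nu_h X) (\<lambda>\<rho>. len X \<rho> *\<^sub>R \<phi> \<rho>)"
    if "\<phi> \<in> Vh J" for \<phi>
    unfolding lhs[OF w that] rhs[OF that]
  proof (rule sum.cong)
    fix j assume j: "j \<in> {1..J}"
    show "mass J X j * (w (node J j) \<bullet> \<phi> (node J j)) = \<phi> (node J j) \<bullet> (- (1/2) *\<^sub>R perp (chord J X j))"
      unfolding w_node[OF j] using mass_nz[OF j] by (simp add: inner_commute)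
  qed simp
  have "omega_h J X = w"
    unfolding omega_h_def
  proof (rule the_equality)
    show "w \<in> Vh J \<and> (\<forall>\<phi>\<in>Vh J. ip_h J w (\<lambda>\<rho>. len X \<rho> *\<^sub>R \<phi> \<rho>) = ip_h J (nu_h X) (\<lambda>\<rho>. len X \<rho> *\<^sub>R \<phi> \<rho>))"
      using w w_eq by blast
  next
    fix z assume z: "z \<in> Vh J \<and> (\<forall>\<phi>\<in>Vh J. ip_h J z (\<lambda>\<rho>. len X \<rho> *\<^sub>R \<phi> \<rho>) = ip_h J (nu_h X) (\<lambda>\<rho>. len X \<rho> *\<^sub>R \<phi> \<rho>))"
    \<comment> \<open>Testing with the difference of two solutions gives a vanishing sum of
      nonnegative terms, so the difference is zero at every node.\<close>
    define \<phi> where "\<phi> \<rho> = z \<rho> + (- 1) *\<^sub>R w \<rho>" for \<rho>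
    have "\<phi> \<in> Vh J"
    proof -
      have "(\<lambda>\<rho>. (- 1) *\<^sub>R w \<rho>) \<in> Vh J"
        using w by (rule Vh_bounded_linear[OF bounded_linear_scaleR_right])
      then show ?thesis unfolding \<phi>_def using z by (intro Vh_add) auto
    qed
    then have "(\<Sum>j=1..J. mass J X j * (z (node J j) \<bullet> \<phi> (node J j))) =
        (\<Sum>j=1..J. mass J X j * (w (node J j) \<bullet> \<phi> (node J j)))"
      using z w_eq lhs[OF w, of \<phi>] lhs[of z \<phi>] by simp
    then have "(\<Sum>j=1..J. mass J X j * (\<phi> (node J j) \<bullet> \<phi> (node J j))) = 0"
      by (simp add: \<phi>_def algebra_simps sum.distrib sum_subtractf sum_negf)
    then have "\<forall>j\<in>{1..J}. mass J X j * (\<phi> (node J j) \<bullet> \<phi> (node J j)) = 0"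
      by (subst (asm) sum_nonneg_eq_0_iff) (use mass in \<open>auto simp: less_imp_le\<close>)
    then have "\<phi> (node J j) = 0" if "j \<in> {1..J}" for j
      using mass_nz that by fastforce
    then have "z (node J j) = w (node J j)" if "j \<in> {1..J}" for j
      using that unfolding \<phi>_def by simp
    then show "z = w" using z by (intro Vh_eqI[OF J0 _ w]) blast+
  qed
  then show "omega_h J X \<in> Vh J"
    and "j \<in> {1..J} \<Longrightarrow> omega_h J X (node J j) = (- 1 / (2 * mass J X j)) *\<^sub>R perp (chord J X j)"
    using w w_node by auto
qed

section \<open>Derivatives of the logarithm of the metric\<close>

lemma grad_eqI:
  assumes "GDERIV f x :> D"
  shows "grad f x = D"
  unfolding grad_def
proof (rule the_equality)
  show "GDERIV f x :> D" by (rule assms)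
  fix E assume "GDERIV f x :> E"
  with assms have "(\<lambda>h. h \<bullet> D) = (\<lambda>h. h \<bullet> E)"
    unfolding gderiv_def by (rule has_derivative_unique)
  then have "h \<bullet> D = h \<bullet> E" for h by meson
  then show "E = D" by (metis vector_eq_ldot)
qed

lemma differentiable_imp_GDERIV:
  fixes f :: "'a::euclidean_space \<Rightarrow> real"
  assumes "f differentiable (at x)"
  shows "GDERIV f x :> (\<Sum>b\<in>Basis. frechet_derivative f (at x) b *\<^sub>R b)"
proof -
  have D: "(f has_derivative frechet_derivative f (at x)) (at x)"
    using assms by (simp add: frechet_derivative_works)
  interpret linear "frechet_derivative f (at x)"
    using D by (rule has_derivative_linear)
  have "frechet_derivative f (at x) h = h \<bullet> (\<Sum>b\<in>Basis. frechet_derivative f (at x) b *\<^sub>R b)" for h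
  proof -
    have "frechet_derivative f (at x) h = frechet_derivative f (at x) (\<Sum>b\<in>Basis. (h \<bullet> b) *\<^sub>R b)"
      by (simp add: euclidean_representation)
    also have "\<dots> = (\<Sum>b\<in>Basis. (h \<bullet> b) * frechet_derivative f (at x) b)"
      by (simp add: sum scale)
    finally show ?thesis by (simp add: inner_sum_right mult.commute)
  qed
  then have "frechet_derivative f (at x) = (\<lambda>h. h \<bullet> (\<Sum>b\<in>Basis. frechet_derivative f (at x) b *\<^sub>R b))"
    by (rule ext)
  with D show ?thesis unfolding gderiv_def by simp
qed

context
  fixes H :: "(real^'n) set" and g :: "real^'n \<Rightarrow> real"
  assumes H: "open H" and g: "smooth_on g H" and pos: "\<And>x. x \<in> H \<Longrightarrow> g x > 0"
begin

private definition "G x = (\<Sum>b\<in>Basis. frechet_derivative g (at x) b *\<^sub>R b)"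

text \<open>The Hessian of \<open>g\<close> at \<open>x\<close> applied to \<open>w\<close>, written
  with iterated partial derivatives since these are what \<open>smooth_on\<close> speaks
  about.\<close>

private definition "D2 x w = (\<Sum>b\<in>Basis. frechet_derivative (\<lambda>x. frechet_derivative g (at x) b) (at x) w *\<^sub>R b)"

private lemma g_GDERIV: "x \<in> H \<Longrightarrow> GDERIV g x :> G x"
proof -
  have "cont_diff_on (Suc 0) g H" using g unfolding smooth_on_def by blast
  then show "x \<in> H \<Longrightarrow> GDERIV g x :> G x"
    unfolding G_def by (intro differentiable_imp_GDERIV) simp
qed

private lemma partial_differentiable:
  assumes "x \<in> H" "b \<in> Basis"
  shows "(\<lambda>x. frechet_derivative g (at x) b) differentiable (at x)"
proof -
  have "cont_diff_on (Suc (Suc 0)) g H" using g unfolding smooth_on_def by blast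
  then show ?thesis using assms by simp
qed

private lemma partial2_continuous:
  assumes "b \<in> Basis" "c \<in> Basis"
  shows "continuous_on H (\<lambda>x. frechet_derivative (\<lambda>x. frechet_derivative g (at x) b) (at x) c)"
proof -
  have "cont_diff_on (Suc (Suc 0)) g H" using g unfolding smooth_on_def by blast
  then show ?thesis using assms by simp
qed

private lemma G_has_derivative: "x \<in> H \<Longrightarrow> (G has_derivative D2 x) (at x)"
  unfolding G_def D2_def
  by (intro has_derivative_sum has_derivative_scaleR_left)
    (auto simp: partial_differentiable simp flip: frechet_derivative_works)

lemma ln_GDERIV:
  assumes "x \<in> H"
  shows "GDERIV (\<lambda>x. ln (g x)) x :> grad (\<lambda>x. ln (g x)) x"
proof -
  have "GDERIV (\<lambda>x. ln (g x)) x :> (1 / g x) *\<^sub>R G x"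
    by (rule GDERIV_DERIV_compose[OF g_GDERIV[OF assms] DERIV_ln_divide[OF pos[OF assms]]])
  then show ?thesis using grad_eqI by metis
qed

private lemma grad_ln: "x \<in> H \<Longrightarrow> grad (\<lambda>x. ln (g x)) x = (1 / g x) *\<^sub>R G x"
  by (intro grad_eqI GDERIV_DERIV_compose[OF g_GDERIV DERIV_ln_divide[OF pos]])

text \<open>The quotient rule for the gradient of \<open>g\<close> divided by \<open>g\<close>: an
  explicit form of \<open>hess\<close> of ln g, from which its continuity can be seen.\<close>

private definition "L x w = (1 / g x) *\<^sub>R D2 x w - ((w \<bullet> G x) / (g x)\<^sup>2) *\<^sub>R G x"

private lemma grad_ln_has_derivative_L:
  assumes x: "x \<in> H"
  shows "(grad (\<lambda>x. ln (g x)) has_derivative L x) (at x)"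
proof (rule has_derivative_transform_within_open[OF _ H x])
  have Dg: "(g has_derivative (\<lambda>h. h \<bullet> G x)) (at x)"
    using g_GDERIV[OF x] by (simp add: gderiv_def)
  show "((\<lambda>x. (1 / g x) *\<^sub>R G x) has_derivative L x) (at x)"
    unfolding L_def
    by (rule derivative_eq_intros Dg G_has_derivative[OF x] refl
        | simp add: pos[OF x, THEN less_imp_neq, symmetric] power2_eq_square divide_inverse)+
qed (simp add: grad_ln)

lemma grad_ln_has_derivative:
  assumes x: "x \<in> H"
  shows "(grad (\<lambda>x. ln (g x)) has_derivative (\<lambda>w. hess (\<lambda>x. ln (g x)) x *v w)) (at x)"
  using grad_ln_has_derivative_L[OF x] unfolding hess_def
  by (auto simp: differentiable_def simp flip: jacobian_works)

private lemma hess_ln: "x \<in> H \<Longrightarrow> hess (\<lambda>x. ln (g x)) x *v w = L x w"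
  using has_derivative_unique[OF grad_ln_has_derivative grad_ln_has_derivative_L, of x] by metis

lemma isCont_grad_ln:
  "isCont \<xi> \<rho> \<Longrightarrow> \<xi> \<rho> \<in> H \<Longrightarrow> isCont (\<lambda>\<rho>. grad (\<lambda>x. ln (g x)) (\<xi> \<rho>)) \<rho>"
  by (rule isCont_o2) (auto dest: has_derivative_continuous[OF grad_ln_has_derivative])

lemma isCont_metric: "isCont \<xi> \<rho> \<Longrightarrow> \<xi> \<rho> \<in> H \<Longrightarrow> isCont (\<lambda>\<rho>. g (\<xi> \<rho>)) \<rho>"
  by (rule isCont_o2[of \<rho> \<xi> g])
    (auto dest!: g_GDERIV has_derivative_continuous simp: gderiv_def)

text \<open>Smoothness gives continuity of the second partials along basis vectors only. Expanding
  the direction in the basis reduces the joint dependence on base point and direction to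
  these.\<close>

lemma isCont_hess_ln:
  assumes \<xi>: "isCont \<xi> \<rho>" "\<And>\<rho>. \<xi> \<rho> \<in> H" and \<phi>: "isCont \<phi> \<rho>"
  shows "isCont (\<lambda>\<rho>. hess (\<lambda>x. ln (g x)) (\<xi> \<rho>) *v \<phi> \<rho>) \<rho>"
proof -
  have D2: "D2 x w = (\<Sum>b\<in>Basis. (\<Sum>c\<in>Basis. (w \<bullet> c) *
      frechet_derivative (\<lambda>x. frechet_derivative g (at x) b) (at x) c) *\<^sub>R b)" if "x \<in> H" for x w
    unfolding D2_def
  proof (rule sum.cong[OF refl])
    fix b :: "real^'n" assume b: "b \<in> Basis"
    let ?F = "frechet_derivative (\<lambda>x. frechet_derivative g (at x) b) (at x)"
    interpret linear ?F
      using partial_differentiable[OF that b] by (rule linear_frechet_derivative)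
    have "?F w = ?F (\<Sum>c\<in>Basis. (w \<bullet> c) *\<^sub>R c)" by (simp add: euclidean_representation)
    also have "\<dots> = (\<Sum>c\<in>Basis. (w \<bullet> c) * ?F c)" by (simp add: sum scale)
    finally show "?F w *\<^sub>R b = (\<Sum>c\<in>Basis. (w \<bullet> c) * ?F c) *\<^sub>R b" by simp
  qed
  have c2: "isCont (\<lambda>\<rho>. frechet_derivative (\<lambda>x. frechet_derivative g (at x) b) (at (\<xi> \<rho>)) c) \<rho>"
    if "b \<in> Basis" "c \<in> Basis" for b c :: "real^'n"
  proof (rule isCont_o2[OF \<xi>(1)])
    show "isCont (\<lambda>x. frechet_derivative (\<lambda>x. frechet_derivative g (at x) b) (at x) c) (\<xi> \<rho>)"
      using partial2_continuous[OF that] H \<xi>(2) continuous_on_eq_continuous_at by blast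
  qed
  have cG: "isCont (\<lambda>\<rho>. G (\<xi> \<rho>)) \<rho>"
    by (rule isCont_o2[OF \<xi>(1)]) (use G_has_derivative[OF \<xi>(2)] has_derivative_continuous in blast)
  have "isCont (\<lambda>\<rho>. L (\<xi> \<rho>) (\<phi> \<rho>)) \<rho>"
    unfolding L_def D2[OF \<xi>(2)]
    by (intro continuous_intros c2 \<phi> cG isCont_metric \<xi>) (auto simp: pos[OF \<xi>(2), THEN less_imp_neq, symmetric])
  then show ?thesis by (simp add: hess_ln[OF \<xi>(2)])
qed

end

section \<open>Nodal form of the scheme\<close>

text \<open>Nodal value of \<open>n\<^sup>h\<close>: the length weights in \<open>\<omega>\<^sup>h\<close> cancel in the average
  of the two adjacent element normals, leaving the direction of the chord between the neighbours.\<close>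

definition normal :: "nat \<Rightarrow> (real \<Rightarrow> real^2) \<Rightarrow> nat \<Rightarrow> real^2" where
  "normal J X j = - perp (sgn (chord J X j))"

definition nodal_A :: "nat \<Rightarrow> (real^2 \<Rightarrow> real) \<Rightarrow> (real \<Rightarrow> real^2) \<Rightarrow> (real \<Rightarrow> real) \<Rightarrow> nat \<Rightarrow> real" where
  "nodal_A J g X \<kappa> j = \<kappa> (node J j) - 1/2 * (normal J X j \<bullet> grad (\<lambda>x. ln (g x)) (X (node J j)))"

text \<open>The curve frozen at one time; \<open>edge_nz\<close> and \<open>chord_nz\<close> are the
  two non-degeneracy assumptions in terms of increments.\<close>

locale polygon =
  fixes J :: nat and X :: "real \<Rightarrow> real^2" and H :: "(real^2) set" and g :: "real^2 \<Rightarrow> real"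
  assumes J: "J \<ge> 2" and X: "X \<in> Vh J"
    and edge_nz: "\<And>j. j \<in> {1..J} \<Longrightarrow> edge J X j \<noteq> 0"
    and chord_nz: "\<And>j. j \<in> {1..J} \<Longrightarrow> chord J X j \<noteq> 0"
    and H: "open H" and g: "smooth_on g H" and pos: "\<And>x. x \<in> H \<Longrightarrow> g x > 0"
    and X_in_H: "\<And>\<rho>. X \<rho> \<in> H"
begin

abbreviation "lng \<equiv> (\<lambda>x. ln (g x))"

lemma J0: "J > 0" using J by simp

lemma mass_pos: "j \<in> {1..J} \<Longrightarrow> mass J X j > 0"
  using edge_nz[of j] unfolding mass_def by (simp add: add_pos_nonneg)

lemma omega_in_Vh: "omega_h J X \<in> Vh J"
  using omega_h_in_Vh[OF J X edge_nz] .

lemma omega_node: "j \<in> {1..J} \<Longrightarrow> omega_h J X (node J j) = (- 1 / (2 * mass J X j)) *\<^sub>R perp (chord J X j)"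
  using omega_h_node[OF J X edge_nz] .

lemma norm_omega_node:
  assumes "j \<in> {1..J}" shows "norm (omega_h J X (node J j)) = norm (chord J X j) / (2 * mass J X j)"
  using mass_pos[OF assms] by (simp add: omega_node[OF assms])

text \<open>Index 0 is included because the lumped product also takes a limit at the left end of the
  first element.\<close>

lemma omega_node_nz:
  assumes "j \<le> J" shows "omega_h J X (node J j) \<noteq> 0"
proof -
  have nz: "omega_h J X (node J i) \<noteq> 0" if "i \<in> {1..J}" for i
    using chord_nz[OF that] mass_pos[OF that] by (simp add: omega_node[OF that])
  show ?thesis
  proof (cases "j = 0")
    case True
    then show ?thesis using nz[of J] J0 Vh_node_0[OF omega_in_Vh J0] by simp
  qed (use nz[of j] assms in auto)
qed

lemma n_h_node:
  assumes "j \<in> {1..J}" shows "n_h J X (node J j) = normal J X j"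
proof -
  have "n_h J X (node J j) = sgn (omega_h J X (node J j))"
    by (simp add: n_h_def sgn_div_norm)
  also have "\<dots> = normal J X j"
    using mass_pos[OF assms]
    by (simp add: omega_node[OF assms] normal_def sgn_perp sgn_minus sgn_scaleR)
  finally show ?thesis .
qed

lemma A_h_node: "j \<in> {1..J} \<Longrightarrow> A_h J g X \<kappa> (node J j) = nodal_A J g X \<kappa> j"
  by (simp add: A_h_def nodal_A_def n_h_node)

lemma isCont_omega: "isCont (omega_h J X) \<rho>"
  using omega_in_Vh by (rule Vh_isCont)

lemma isCont_n_h: "j \<le> J \<Longrightarrow> isCont (n_h J X) (node J j)"
  unfolding n_h_def using omega_node_nz by (intro continuous_intros isCont_omega) auto

lemma isCont_X: "isCont X \<rho>"
  using X by (rule Vh_isCont)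

lemma isCont_gX: "isCont (\<lambda>\<rho>. g (X \<rho>)) \<rho>"
  by (rule isCont_metric[OF H g pos isCont_X X_in_H])

lemma gX_nz: "g (X \<rho>) \<noteq> 0"
  using pos[OF X_in_H, of \<rho>] by simp

lemma isCont_gX_powr: "isCont (\<lambda>\<rho>. g (X \<rho>) powr a) \<rho>"
  by (intro continuous_intros isCont_gX) (simp add: gX_nz)

lemma isCont_gradX: "isCont (\<lambda>\<rho>. grad lng (X \<rho>)) \<rho>"
  by (rule isCont_grad_ln[OF H g pos isCont_X X_in_H])

lemma isCont_hessX: "isCont \<phi> \<rho> \<Longrightarrow> isCont (\<lambda>\<rho>. hess lng (X \<rho>) *v \<phi> \<rho>) \<rho>"
  by (rule isCont_hess_ln[OF H g pos isCont_X X_in_H])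

lemma isCont_A_h: "\<kappa> \<in> Vh J \<Longrightarrow> j \<le> J \<Longrightarrow> isCont (A_h J g X \<kappa>) (node J j)"
  unfolding A_h_def by (intro continuous_intros isCont_n_h isCont_gradX) (rule Vh_isCont)

lemmas isConts = isCont_omega isCont_n_h isCont_X isCont_gX_powr isCont_gradX isCont_hessX isCont_A_h

lemma n_h_1: "n_h J X 1 = n_h J X 0"
  by (simp add: n_h_def Vh_1[OF omega_in_Vh])

lemma A_h_1: "\<kappa> \<in> Vh J \<Longrightarrow> A_h J g X \<kappa> 1 = A_h J g X \<kappa> 0"
  by (simp add: A_h_def n_h_1 Vh_1[OF X] Vh_1)

lemmas periodic_simps = n_h_1 A_h_1 Vh_1 Vh_1[OF X] Vh_1[OF omega_in_Vh]

lemma W_h_nodal: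
  assumes \<kappa>: "\<kappa> \<in> Vh J"
  shows "W_h J g lam X \<kappa> = 1/2 * (\<Sum>j=1..J. mass J X j *
    (g (X (node J j)) powr (-1/2) * (nodal_A J g X \<kappa> j)\<^sup>2 + 2 * lam * g (X (node J j)) powr (1/2)))"
proof -
  have "W_h J g lam X \<kappa> = 1/2 * ip_h J
     (\<lambda>\<rho>. g (X \<rho>) powr (-1/2) * (A_h J g X \<kappa> \<rho>)\<^sup>2 + 2 * lam * g (X \<rho>) powr (1/2)) (len X)"
    by (simp add: W_h_def A_h_def n_h_def)
  also have "ip_h J (\<lambda>\<rho>. g (X \<rho>) powr (-1/2) * (A_h J g X \<kappa> \<rho>)\<^sup>2 + 2 * lam * g (X \<rho>) powr (1/2)) (len X)
    = (\<Sum>j=1..J. mass J X j * (g (X (node J j)) powr (-1/2) * (A_h J g X \<kappa> (node J j))\<^sup>2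
        + 2 * lam * g (X (node J j)) powr (1/2)))"
    by (rule ip_h_len[OF J0 X])
      (use \<kappa> in \<open>auto intro!: continuous_intros isConts \<kappa>[THEN Vh_isCont] simp: periodic_simps\<close>)
  finally show ?thesis by (simp add: A_h_node)
qed

lemma dissipation_nodal:
  assumes V: "V \<in> Vh J"
  shows "ip_h J (\<lambda>\<rho>. g (X \<rho>) powr (3/2) * (V \<rho> \<bullet> omega_h J X \<rho>)\<^sup>2) (len X) =
    (\<Sum>j=1..J. mass J X j * (g (X (node J j)) powr (3/2) * (V (node J j) \<bullet> omega_h J X (node J j))\<^sup>2))"
  by (rule ip_h_len[OF J0 X])
    (use V in \<open>auto intro!: continuous_intros isConts V[THEN Vh_isCont] simp: periodic_simps\<close>)

text \<open>The rotation is moved from the normal onto \<open>\<eta>\<close>. The curve then enters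
  the first sum linearly through its chords, which is convenient for differentiating in time with
  \<open>\<eta>\<close> fixed.\<close>

lemma scheme_iii_nodal:
  assumes "scheme_iii J X \<kappa>" and \<kappa>: "\<kappa> \<in> Vh J" and \<eta>: "\<eta> \<in> Vh J"
  shows "(\<Sum>j=1..J. \<kappa> (node J j) * (perp (\<eta> (node J j)) \<bullet> (1/2) *\<^sub>R chord J X j))
    + (\<Sum>j=1..J. sgn (edge J X j) \<bullet> edge J \<eta> j) = 0"
proof -
  have "ip_h J (\<lambda>\<rho>. \<kappa> \<rho> *\<^sub>R nu_h X \<rho>) (\<lambda>\<rho>. len X \<rho> *\<^sub>R \<eta> \<rho>) =
     (\<Sum>j=1..J. (\<kappa> (node J j) *\<^sub>R perp (\<eta> (node J j))) \<bullet> ((1/2) *\<^sub>R (edge J X j + edge J X (Suc j))))"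
  proof (rule ip_h_lumped[OF J0])
    fix j \<rho> assume j: "j \<in> {1..J}" "\<rho> \<in> {node J (j - 1)<..<node J j}"
    show "(\<kappa> \<rho> *\<^sub>R nu_h X \<rho>) \<bullet> (len X \<rho> *\<^sub>R \<eta> \<rho>) = real J * ((\<kappa> \<rho> *\<^sub>R perp (\<eta> \<rho>)) \<bullet> edge J X j)"
      using edge_nz[OF j(1)]
      by (simp add: nu_element[OF J0 X j] len_element[OF J0 X j] sgn_div_norm perp_scaleR
          perp_inner_left inner_commute)
  qed (use \<kappa> \<eta> in \<open>auto intro!: continuous_intros isConts \<kappa>[THEN Vh_isCont] \<eta>[THEN Vh_isCont] simp: periodic_simps edge_wrap X J0\<close>)
  moreover have "ip (d_s X X) (\<lambda>\<rho>. len X \<rho> *\<^sub>R d_s X \<eta> \<rho>) = (\<Sum>j=1..J. sgn (edge J X j) \<bullet> edge J \<eta> j)"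
  proof (rule ip_piecewise[OF J0])
    fix j \<rho> assume j: "j \<in> {1..J}" "\<rho> \<in> {node J (j - 1)<..<node J j}"
    show "d_s X X \<rho> \<bullet> (len X \<rho> *\<^sub>R d_s X \<eta> \<rho>) = real J * (sgn (edge J X j) \<bullet> edge J \<eta> j)"
      using edge_nz[OF j(1)]
      by (simp add: d_s_element[OF J0 X j X] d_s_element[OF J0 X j \<eta>] len_element[OF J0 X j] sgn_div_norm)
  qed
  moreover have "ip_h J (\<lambda>\<rho>. \<kappa> \<rho> *\<^sub>R nu_h X \<rho>) (\<lambda>\<rho>. len X \<rho> *\<^sub>R \<eta> \<rho>)
      + ip (d_s X X) (\<lambda>\<rho>. len X \<rho> *\<^sub>R d_s X \<eta> \<rho>) = 0"
    using assms(1) \<eta> unfolding scheme_iii_def by blast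
  ultimately show ?thesis by (simp only: chord_def inner_scaleR_left)
qed

text \<open>The right-hand side has the shape of the first sum in \<open>scheme_iii_deriv\<close>:
  with the time derivative of \<open>\<kappa>\<close> for \<open>\<phi>\<close> and \<open>Y\<close>
  for \<open>\<eta>\<close> the two coincide.\<close>

lemma scheme_ii_nodal:
  assumes "scheme_ii J g X \<kappa> Y" and \<kappa>: "\<kappa> \<in> Vh J" and Y: "Y \<in> Vh J" and \<phi>: "\<phi> \<in> Vh J"
  shows "(\<Sum>j=1..J. mass J X j * (g (X (node J j)) powr (-1/2) * nodal_A J g X \<kappa> j * \<phi> (node J j))) =
    (\<Sum>j=1..J. \<phi> (node J j) * (perp (Y (node J j)) \<bullet> (1/2) *\<^sub>R chord J X j))"
proof -
  \<comment> \<open>The two parts of the integrand carry different elementwise factors, |X_rho| and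
    |X_rho| nu. Pairing them in a product space treats both at once and avoids splitting the limits
    in \<open>ip_h\<close>.\<close>
  have "ip_h J (\<lambda>\<rho>. g (X \<rho>) powr (-1/2) * A_h J g X \<kappa> \<rho> - Y \<rho> \<bullet> nu_h X \<rho>) (\<lambda>\<rho>. \<phi> \<rho> * len X \<rho>) =
     (\<Sum>j=1..J. (g (X (node J j)) powr (-1/2) * A_h J g X \<kappa> (node J j) * \<phi> (node J j), \<phi> (node J j) *\<^sub>R perp (Y (node J j)))
       \<bullet> ((1/2) *\<^sub>R ((norm (edge J X j), - edge J X j) + (norm (edge J X (Suc j)), - edge J X (Suc j)))))"
  proof (rule ip_h_lumped[OF J0])
    fix j \<rho> assume j: "j \<in> {1..J}" "\<rho> \<in> {node J (j - 1)<..<node J j}"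
    show "(g (X \<rho>) powr (-1/2) * A_h J g X \<kappa> \<rho> - Y \<rho> \<bullet> nu_h X \<rho>) \<bullet> (\<phi> \<rho> * len X \<rho>) =
       real J * ((g (X \<rho>) powr (-1/2) * A_h J g X \<kappa> \<rho> * \<phi> \<rho>, \<phi> \<rho> *\<^sub>R perp (Y \<rho>))
         \<bullet> (norm (edge J X j), - edge J X j))"
      using edge_nz[OF j(1)]
      by (simp add: nu_element[OF J0 X j] len_element[OF J0 X j] sgn_div_norm perp_scaleR
          perp_inner_left field_simps)
  qed (use \<kappa> \<phi> Y in \<open>auto intro!: continuous_intros isConts \<kappa>[THEN Vh_isCont] \<phi>[THEN Vh_isCont] Y[THEN Vh_isCont] simp: periodic_simps edge_wrap X J0\<close>)
  also have "\<dots> = (\<Sum>j=1..J. mass J X j * (g (X (node J j)) powr (-1/2) * nodal_A J g X \<kappa> j * \<phi> (node J j))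
      - \<phi> (node J j) * (perp (Y (node J j)) \<bullet> (1/2) *\<^sub>R chord J X j))"
    by (intro sum.cong) (auto simp: A_h_node mass_def chord_def algebra_simps inner_add_right add_divide_distrib)
  finally show ?thesis
    using assms(1) \<phi> unfolding scheme_ii_def by (simp add: sum_subtractf)
qed

text \<open>Equation (i) with the velocity \<open>V\<close> as test function. The sums are arranged
  as in \<open>W_h_deriv\<close>, so that they can later be compared as whole terms.\<close>

lemma scheme_i_nodal:
  assumes "scheme_i J g lam X V \<kappa> Y" and \<kappa>: "\<kappa> \<in> Vh J" and Y: "Y \<in> Vh J" and V: "V \<in> Vh J"
  defines "x \<equiv> \<lambda>j. X (node J j)" and "v \<equiv> \<lambda>j. V (node J j)" and "A \<equiv> nodal_A J g X \<kappa>" and "n \<equiv> normal J X"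
  shows "(\<Sum>j=1..J. mass J X j * (g (x j) powr (3/2) * (v j \<bullet> omega_h J X (node J j))\<^sup>2)) =
     (\<Sum>j=1..J. inverse (norm (edge J X j)) * (perp (sgn (edge J X j)) \<bullet> edge J Y j) * (perp (sgn (edge J X j)) \<bullet> edge J V j))
   - 1/2 * (\<Sum>j=1..J. (g (x j) powr (-1/2) * (A j)\<^sup>2 + 2 * lam * g (x j) powr (1/2)) *
        ((sgn (edge J X j) \<bullet> edge J V j + sgn (edge J X (Suc j)) \<bullet> edge J V (Suc j)) / 2))
   + 1/4 * (\<Sum>j=1..J. mass J X j * ((g (x j) powr (-1/2) * (A j)\<^sup>2 - 2 * lam * g (x j) powr (1/2)) *
        (v j \<bullet> grad lng (x j))))
   + 1/2 * (\<Sum>j=1..J. mass J X j * (g (x j) powr (-1/2) * A j * (n j \<bullet> (hess lng (x j) *v v j))))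
   - 1/2 * (\<Sum>j=1..J. mass J X j * (g (x j) powr (-1/2) * A j * 
        ((grad lng (x j) \<bullet> perp (n j)) / norm (chord J X j) * (n j \<bullet> chord J V j))))
   + (\<Sum>j=1..J. \<kappa> (node J j) * (perp (Y (node J j)) \<bullet> (1/2) *\<^sub>R chord J V j))"
    (is "?lhs = ?s1 - 1/2 * ?s2 + 1/4 * ?s3 + 1/2 * ?s4 - 1/2 * ?s5 + ?s6")
proof -
  let ?\<omega> = "omega_h J X" and ?n = "n_h J X" and ?A = "A_h J g X \<kappa>"
  note cont = continuous_intros isConts \<kappa>[THEN Vh_isCont] Y[THEN Vh_isCont] V[THEN Vh_isCont]
  have lhs: "ip_h J (\<lambda>\<rho>. g (X \<rho>) powr (3/2) * (V \<rho> \<bullet> ?\<omega> \<rho>)) (\<lambda>\<rho>. (V \<rho> \<bullet> ?\<omega> \<rho>) * len X \<rho>) = ?lhs"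
    unfolding x_def v_def
    by (rule ip_h_len[OF J0 X])
      (use V in \<open>auto intro!: cont simp: periodic_simps power2_eq_square\<close>)
  have s1: "ip (\<lambda>\<rho>. d_s X Y \<rho> \<bullet> nu_h X \<rho>) (\<lambda>\<rho>. (d_s X V \<rho> \<bullet> nu_h X \<rho>) * len X \<rho>) = ?s1"
  proof (rule ip_piecewise[OF J0])
    fix j \<rho> assume j: "j \<in> {1..J}" "\<rho> \<in> {node J (j - 1)<..<node J j}"
    show "(d_s X Y \<rho> \<bullet> nu_h X \<rho>) \<bullet> ((d_s X V \<rho> \<bullet> nu_h X \<rho>) * len X \<rho>) = real J * (inverse (norm (edge J X j)) *
       (perp (sgn (edge J X j)) \<bullet> edge J Y j) * (perp (sgn (edge J X j)) \<bullet> edge J V j))"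
      using edge_nz[OF j(1)]
      by (simp add: nu_element[OF J0 X j] len_element[OF J0 X j] d_s_element[OF J0 X j Y]
          d_s_element[OF J0 X j V] inner_commute)
  qed
  have s2: "ip_h J (\<lambda>\<rho>. g (X \<rho>) powr (-1/2) * (?A \<rho>)\<^sup>2 + 2 * lam * g (X \<rho>) powr (1/2))
           (\<lambda>\<rho>. (d_s X V \<rho> \<bullet> tau_h X \<rho>) * len X \<rho>) =
      (\<Sum>j=1..J. (g (x j) powr (-1/2) * (?A (node J j))\<^sup>2 + 2 * lam * g (x j) powr (1/2)) \<bullet>
        ((1/2) *\<^sub>R (sgn (edge J X j) \<bullet> edge J V j + sgn (edge J X (Suc j)) \<bullet> edge J V (Suc j))))"
    unfolding x_def
  proof (rule ip_h_lumped[OF J0])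
    fix j \<rho> assume j: "j \<in> {1..J}" "\<rho> \<in> {node J (j - 1)<..<node J j}"
    show "(g (X \<rho>) powr (-1/2) * (?A \<rho>)\<^sup>2 + 2 * lam * g (X \<rho>) powr (1/2)) \<bullet>
        ((d_s X V \<rho> \<bullet> tau_h X \<rho>) * len X \<rho>) =
      real J * ((g (X \<rho>) powr (-1/2) * (?A \<rho>)\<^sup>2 + 2 * lam * g (X \<rho>) powr (1/2)) \<bullet> (sgn (edge J X j) \<bullet> edge J V j))"
      using edge_nz[OF j(1)]
      by (simp add: tau_element[OF J0 X j] len_element[OF J0 X j] d_s_element[OF J0 X j V] inner_commute)
  qed (use \<kappa> V in \<open>auto intro!: cont simp: periodic_simps edge_wrap X J0\<close>)
  have s3: "ip_h J (\<lambda>\<rho>. g (X \<rho>) powr (-1/2) * (?A \<rho>)\<^sup>2 - 2 * lam * g (X \<rho>) powr (1/2))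
           (\<lambda>\<rho>. (V \<rho> \<bullet> grad lng (X \<rho>)) * len X \<rho>) =
      (\<Sum>j=1..J. mass J X j * ((g (x j) powr (-1/2) * (?A (node J j))\<^sup>2 - 2 * lam * g (x j) powr (1/2)) *
        (v j \<bullet> grad lng (x j))))"
    unfolding x_def v_def
    by (rule ip_h_len[OF J0 X]) (use \<kappa> V in \<open>auto intro!: cont simp: periodic_simps\<close>)
  have s4: "ip_h J (\<lambda>\<rho>. (g (X \<rho>) powr (-1/2) * ?A \<rho>) *\<^sub>R ?n \<rho>)
           (\<lambda>\<rho>. len X \<rho> *\<^sub>R (hess lng (X \<rho>) *v V \<rho>)) =
      (\<Sum>j=1..J. mass J X j * (g (x j) powr (-1/2) * ?A (node J j) * (?n (node J j) \<bullet> (hess lng (x j) *v v j))))"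
    unfolding x_def v_def
    by (rule ip_h_len[OF J0 X]) (use \<kappa> V in \<open>auto intro!: cont simp: periodic_simps\<close>)
  have s5: "ip_h J (\<lambda>\<rho>. g (X \<rho>) powr (-1/2) * ?A \<rho> *
                  ((inverse (norm (?\<omega> \<rho>)) *\<^sub>R grad lng (X \<rho>)) \<bullet> perp (?n \<rho>)))
           (\<lambda>\<rho>. (?n \<rho> \<bullet> d_s X V \<rho>) * len X \<rho>) =
      (\<Sum>j=1..J. ((g (x j) powr (-1/2) * ?A (node J j) *
          ((inverse (norm (?\<omega> (node J j))) *\<^sub>R grad lng (x j)) \<bullet> perp (?n (node J j)))) *\<^sub>R ?n (node J j)) \<bullet>
        ((1/2) *\<^sub>R (edge J V j + edge J V (Suc j))))"
    unfolding x_def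
  proof (rule ip_h_lumped[OF J0])
    fix j \<rho> assume j: "j \<in> {1..J}" "\<rho> \<in> {node J (j - 1)<..<node J j}"
    show "(g (X \<rho>) powr (-1/2) * ?A \<rho> * ((inverse (norm (?\<omega> \<rho>)) *\<^sub>R grad lng (X \<rho>)) \<bullet> perp (?n \<rho>))) \<bullet>
        ((?n \<rho> \<bullet> d_s X V \<rho>) * len X \<rho>) =
      real J * (((g (X \<rho>) powr (-1/2) * ?A \<rho> * ((inverse (norm (?\<omega> \<rho>)) *\<^sub>R grad lng (X \<rho>)) \<bullet> perp (?n \<rho>)))
         *\<^sub>R ?n \<rho>) \<bullet> edge J V j)"
      using edge_nz[OF j(1)]
      by (simp add: len_element[OF J0 X j] d_s_element[OF J0 X j V])
  qed (use \<kappa> V in \<open>auto intro!: cont simp: periodic_simps edge_wrap J0 omega_node_nz\<close>)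
  have s6: "ip_h J (\<lambda>\<rho>. \<kappa> \<rho> *\<^sub>R perp (Y \<rho>)) (\<lambda>\<rho>. len X \<rho> *\<^sub>R d_s X V \<rho>) =
      (\<Sum>j=1..J. (\<kappa> (node J j) *\<^sub>R perp (Y (node J j))) \<bullet> ((1/2) *\<^sub>R (edge J V j + edge J V (Suc j))))"
  proof (rule ip_h_lumped[OF J0])
    fix j \<rho> assume j: "j \<in> {1..J}" "\<rho> \<in> {node J (j - 1)<..<node J j}"
    show "(\<kappa> \<rho> *\<^sub>R perp (Y \<rho>)) \<bullet> (len X \<rho> *\<^sub>R d_s X V \<rho>) = real J * ((\<kappa> \<rho> *\<^sub>R perp (Y \<rho>)) \<bullet> edge J V j)"
      using edge_nz[OF j(1)]
      by (simp add: len_element[OF J0 X j] d_s_element[OF J0 X j V])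
  qed (use \<kappa> Y V in \<open>auto intro!: cont simp: periodic_simps edge_wrap J0\<close>)
  \<comment> \<open>In |X_rho| chi_s the length cancels, so this term has lost its mass weight. The
    factor 1/|omega| = 2 * mass / |chord| restores it.\<close>
  have s5': "((g (x j) powr (-1/2) * ?A (node J j) *
          ((inverse (norm (?\<omega> (node J j))) *\<^sub>R grad lng (x j)) \<bullet> perp (?n (node J j)))) *\<^sub>R ?n (node J j)) \<bullet>
        ((1/2) *\<^sub>R (edge J V j + edge J V (Suc j)))
     = mass J X j * (g (x j) powr (-1/2) * A j * 
        ((grad lng (x j) \<bullet> perp (n j)) / norm (chord J X j) * (n j \<bullet> chord J V j)))" if "j \<in> {1..J}" for j
    using that unfolding norm_omega_node[OF that] n_h_node[OF that] A_h_node[OF that]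
    by (simp add: A_def n_def chord_def divide_simps)
  have A: "?A (node J j) = A j" "?n (node J j) = n j" if "j \<in> {1..J}" for j
    using that by (simp_all add: A_def n_def A_h_node n_h_node)
  have e2: "(\<Sum>j=1..J. (g (x j) powr (-1/2) * (?A (node J j))\<^sup>2 + 2 * lam * g (x j) powr (1/2)) \<bullet>
        ((1/2) *\<^sub>R (sgn (edge J X j) \<bullet> edge J V j + sgn (edge J X (Suc j)) \<bullet> edge J V (Suc j)))) = ?s2"
    by (rule sum.cong) (simp_all add: A)
  have e3: "(\<Sum>j=1..J. mass J X j * ((g (x j) powr (-1/2) * (?A (node J j))\<^sup>2 - 2 * lam * g (x j) powr (1/2)) *
        (v j \<bullet> grad lng (x j)))) = ?s3"
    by (rule sum.cong) (simp_all add: A)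
  have e4: "(\<Sum>j=1..J. mass J X j * (g (x j) powr (-1/2) * ?A (node J j) * (?n (node J j) \<bullet> (hess lng (x j) *v v j)))) = ?s4"
    by (rule sum.cong) (simp_all add: A)
  have e5: "(\<Sum>j=1..J. ((g (x j) powr (-1/2) * ?A (node J j) *
          ((inverse (norm (?\<omega> (node J j))) *\<^sub>R grad lng (x j)) \<bullet> perp (?n (node J j)))) *\<^sub>R ?n (node J j)) \<bullet>
        ((1/2) *\<^sub>R (edge J V j + edge J V (Suc j)))) = ?s5"
    by (rule sum.cong) (simp_all only: s5')
  have "ip_h J (\<lambda>\<rho>. g (X \<rho>) powr (3/2) * (V \<rho> \<bullet> ?\<omega> \<rho>)) (\<lambda>\<rho>. (V \<rho> \<bullet> ?\<omega> \<rho>) * len X \<rho>)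
     = ip (\<lambda>\<rho>. d_s X Y \<rho> \<bullet> nu_h X \<rho>) (\<lambda>\<rho>. (d_s X V \<rho> \<bullet> nu_h X \<rho>) * len X \<rho>)
       - 1/2 * ip_h J
           (\<lambda>\<rho>. g (X \<rho>) powr (-1/2) * (?A \<rho>)\<^sup>2 + 2 * lam * g (X \<rho>) powr (1/2))
           (\<lambda>\<rho>. (d_s X V \<rho> \<bullet> tau_h X \<rho>) * len X \<rho>)
       + 1/4 * ip_h J
           (\<lambda>\<rho>. g (X \<rho>) powr (-1/2) * (?A \<rho>)\<^sup>2 - 2 * lam * g (X \<rho>) powr (1/2))
           (\<lambda>\<rho>. (V \<rho> \<bullet> grad lng (X \<rho>)) * len X \<rho>)
       + 1/2 * ip_h J
           (\<lambda>\<rho>. (g (X \<rho>) powr (-1/2) * ?A \<rho>) *\<^sub>R ?n \<rho>)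
           (\<lambda>\<rho>. len X \<rho> *\<^sub>R (hess lng (X \<rho>) *v V \<rho>))
       - 1/2 * ip_h J
           (\<lambda>\<rho>. g (X \<rho>) powr (-1/2) * ?A \<rho> *
                  ((inverse (norm (?\<omega> \<rho>)) *\<^sub>R grad lng (X \<rho>)) \<bullet> perp (?n \<rho>)))
           (\<lambda>\<rho>. (?n \<rho> \<bullet> d_s X V \<rho>) * len X \<rho>)
       + ip_h J (\<lambda>\<rho>. \<kappa> \<rho> *\<^sub>R perp (Y \<rho>)) (\<lambda>\<rho>. len X \<rho> *\<^sub>R d_s X V \<rho>)"
    using assms(1) V unfolding scheme_i_def Let_def by (rule bspec)
  then show ?thesis
    unfolding lhs s1 s2 s3 s4 s5 s6 e2 e3 e4 e5
    by (simp only: inner_scaleR_left chord_def)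
qed

end

section \<open>Time derivative of the energy\<close>

lemma has_vector_derivative_compose:
  assumes "(f has_vector_derivative f') (at t within S)" "(h has_derivative h') (at (f t))"
  shows "((\<lambda>s. h (f s)) has_vector_derivative h' f') (at t within S)"
proof -
  have "((\<lambda>s. h (f s)) has_derivative (\<lambda>c. h' (c *\<^sub>R f'))) (at t within S)"
    using assms has_derivative_compose unfolding has_vector_derivative_def by blast
  then show ?thesis
    using linear_scale[OF has_derivative_linear[OF assms(2)]] by (simp add: has_vector_derivative_def)
qed

lemma has_real_derivative_compose_GDERIV:
  assumes "(f has_vector_derivative f') (at t within S)" "GDERIV h (f t) :> D"
  shows "((\<lambda>s. h (f s)) has_real_derivative f' \<bullet> D) (at t within S)"
  using has_vector_derivative_compose[OF assms(1), of h] assms(2)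
  by (simp add: gderiv_def has_real_derivative_iff_has_vector_derivative)

lemma has_real_derivative_inner:
  assumes "(f has_vector_derivative f') (at t within S)" "(h has_vector_derivative h') (at t within S)"
  shows "((\<lambda>s. f s \<bullet> h s) has_real_derivative f t \<bullet> h' + f' \<bullet> h t) (at t within S)"
  using bounded_bilinear.has_vector_derivative[OF bounded_bilinear_inner assms]
  by (simp add: has_real_derivative_iff_has_vector_derivative)

lemma has_real_derivative_inner_const:
  assumes "(f has_vector_derivative f') (at t within S)"
  shows "((\<lambda>s. f s \<bullet> c) has_real_derivative f' \<bullet> c) (at t within S)"
  using has_real_derivative_inner[OF assms has_vector_derivative_const, of c] by simp

lemma has_real_derivative_transform:
  assumes "t \<in> S" "\<And>s. s \<in> S \<Longrightarrow> h s = f s" "(f has_real_derivative D) (at t within S)"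
  shows "(h has_real_derivative D) (at t within S)"
  using has_derivative_transform assms unfolding has_field_derivative_def by blast

text \<open>\<open>V\<close> and \<open>K\<close> are the velocities of \<open>X\<close> and
  \<open>\<kappa>\<close> at the single time \<open>t\<close>. Equation (iii) is required on all of
  \<open>S\<close> because it is going to be differentiated; (i) and (ii) are used at
  \<open>t\<close> only and enter later.\<close>

locale moving_polygon =
  fixes J :: nat and H :: "(real^2) set" and g :: "real^2 \<Rightarrow> real" and S :: "real set"
    and X :: "real \<Rightarrow> real \<Rightarrow> real^2" and V :: "real \<Rightarrow> real^2"
    and \<kappa> :: "real \<Rightarrow> real \<Rightarrow> real" and K :: "real \<Rightarrow> real" and t :: real
  assumes polygon: "\<And>s. s \<in> S \<Longrightarrow> polygon J (X s) H g"
    and t: "t \<in> S" and nontriv: "at t within S \<noteq> bot"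
    and \<kappa>_in_Vh: "\<And>s. s \<in> S \<Longrightarrow> \<kappa> s \<in> Vh J"
    and iii: "\<And>s. s \<in> S \<Longrightarrow> scheme_iii J (X s) (\<kappa> s)"
    and X_deriv: "\<And>\<rho>. ((\<lambda>s. X s \<rho>) has_vector_derivative V \<rho>) (at t within S)"
    and \<kappa>_deriv: "\<And>\<rho>. ((\<lambda>s. \<kappa> s \<rho>) has_real_derivative K \<rho>) (at t within S)"
begin

sublocale polygon J "X t" H g
  by (rule polygon[OF t])

lemma edge_deriv: "((\<lambda>s. edge J (X s) j) has_vector_derivative edge J V j) (at t within S)"
  unfolding edge_def by (intro has_vector_derivative_diff X_deriv)

lemma chord_deriv: "((\<lambda>s. chord J (X s) j) has_vector_derivative chord J V j) (at t within S)"
  unfolding chord_def by (intro has_vector_derivative_add edge_deriv)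

lemma edge_Suc_nz: "j \<in> {1..J} \<Longrightarrow> edge J (X t) (Suc j) \<noteq> 0"
  using edge_nz[of "Suc j"] edge_nz[of 1] edge_wrap[OF X J0] J0 by (cases "j = J") auto

lemma mass_deriv:
  assumes "j \<in> {1..J}"
  shows "((\<lambda>s. mass J (X s) j) has_real_derivative
     (sgn (edge J (X t) j) \<bullet> edge J V j + sgn (edge J (X t) (Suc j)) \<bullet> edge J V (Suc j)) / 2) (at t within S)"
  unfolding mass_def
  by (intro DERIV_cdivide DERIV_add has_real_derivative_norm edge_deriv edge_nz edge_Suc_nz assms)

text \<open>The unit chord rotates, and \<open>perp (sgn (chord ..))\<close> is minus the normal;
  this sign occurs twice in the derivative and cancels. The formula is the origin of the term in (i)
  with the rotated normal.\<close>

lemma normal_deriv: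
  assumes "j \<in> {1..J}"
  shows "((\<lambda>s. normal J (X s) j) has_vector_derivative
     - ((normal J (X t) j \<bullet> chord J V j) / norm (chord J (X t) j)) *\<^sub>R perp (normal J (X t) j)) (at t within S)"
proof -
  have "((\<lambda>s. normal J (X s) j) has_vector_derivative - perp
     (((perp (sgn (chord J (X t) j)) \<bullet> chord J V j) / norm (chord J (X t) j)) *\<^sub>R perp (sgn (chord J (X t) j))))
     (at t within S)"
    unfolding normal_def
    by (intro has_vector_derivative_minus bounded_linear.has_vector_derivative[OF bounded_linear_perp]
        has_vector_derivative_sgn chord_deriv chord_nz assms)
  then show ?thesis by (simp add: normal_def perp_scaleR perp_minus)
qed

text \<open>Written as exp (a * ln g), a power of the metric differentiates directly into the
  gradient of ln g, the form that the scheme uses.\<close>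

lemma powr_deriv:
  "((\<lambda>s. g (X s \<rho>) powr a) has_real_derivative
     a * g (X t \<rho>) powr a * (V \<rho> \<bullet> grad lng (X t \<rho>))) (at t within S)"
proof -
  have exp: "g (X s \<rho>) powr a = exp (a * ln (g (X s \<rho>)))" if "s \<in> S" for s
    using polygon.gX_nz[OF polygon[OF that]] by (simp add: powr_def)
  have "((\<lambda>s. ln (g (X s \<rho>))) has_real_derivative V \<rho> \<bullet> grad lng (X t \<rho>)) (at t within S)"
    by (rule has_real_derivative_compose_GDERIV[OF X_deriv ln_GDERIV[OF H g pos X_in_H]])
  then have "((\<lambda>s. exp (a * ln (g (X s \<rho>)))) has_real_derivative
      exp (a * ln (g (X t \<rho>))) * (a * (V \<rho> \<bullet> grad lng (X t \<rho>)))) (at t within S)"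
    by (intro DERIV_chain2[OF DERIV_exp] DERIV_cmult)
  then have "((\<lambda>s. g (X s \<rho>) powr a) has_real_derivative
      exp (a * ln (g (X t \<rho>))) * (a * (V \<rho> \<bullet> grad lng (X t \<rho>)))) (at t within S)"
    by (intro has_real_derivative_transform[OF t exp])
  then show ?thesis by (simp add: exp[OF t] mult_ac)
qed

lemma nodal_A_deriv:
  assumes "j \<in> {1..J}"
  defines "n \<equiv> normal J (X t) j" and "x \<equiv> X t (node J j)"
  shows "((\<lambda>s. nodal_A J g (X s) (\<kappa> s) j) has_real_derivative
     K (node J j) - 1/2 * (n \<bullet> (hess lng x *v V (node J j))
       - (n \<bullet> chord J V j) / norm (chord J (X t) j) * (perp n \<bullet> grad lng x))) (at t within S)"
proof -
  have "((\<lambda>s. grad lng (X s (node J j))) has_vector_derivative hess lng x *v V (node J j)) (at t within S)"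
    unfolding x_def
    by (rule has_vector_derivative_compose[OF X_deriv grad_ln_has_derivative[OF H g pos X_in_H]])
  from DERIV_diff[OF \<kappa>_deriv DERIV_cmult[OF has_real_derivative_inner[OF normal_deriv[OF assms(1)] this]]]
  show ?thesis
    unfolding nodal_A_def by (rule DERIV_cong) (simp add: n_def x_def)
qed

text \<open>The powers -1/2 and 1/2 of \<open>g\<close> have logarithmic derivatives of opposite
  sign; this flips the sign of \<open>lam\<close> in the second sum and produces its factor 1/4. The
  first four sums are the negatives of those in \<open>scheme_i_nodal\<close>; the last one, with
  \<open>K\<close>, has no counterpart there.\<close>

lemma W_h_deriv:
  defines "x \<equiv> \<lambda>j. X t (node J j)" and "v \<equiv> \<lambda>j. V (node J j)" and "A \<equiv> nodal_A J g (X t) (\<kappa> t)"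
    and "n \<equiv> normal J (X t)"
  shows "((\<lambda>s. W_h J g lam (X s) (\<kappa> s)) has_real_derivative
     (1/2 * (\<Sum>j=1..J. (g (x j) powr (-1/2) * (A j)\<^sup>2 + 2 * lam * g (x j) powr (1/2)) *
        ((sgn (edge J (X t) j) \<bullet> edge J V j + sgn (edge J (X t) (Suc j)) \<bullet> edge J V (Suc j)) / 2))
   - 1/4 * (\<Sum>j=1..J. mass J (X t) j * ((g (x j) powr (-1/2) * (A j)\<^sup>2 - 2 * lam * g (x j) powr (1/2)) *
        (v j \<bullet> grad lng (x j))))
   - 1/2 * (\<Sum>j=1..J. mass J (X t) j * (g (x j) powr (-1/2) * A j * (n j \<bullet> (hess lng (x j) *v v j))))
   + 1/2 * (\<Sum>j=1..J. mass J (X t) j * (g (x j) powr (-1/2) * A j * 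
        ((grad lng (x j) \<bullet> perp (n j)) / norm (chord J (X t) j) * (n j \<bullet> chord J V j))))
   + (\<Sum>j=1..J. mass J (X t) j * (g (x j) powr (-1/2) * A j * K (node J j))))) (at t within S)"
    (is "(_ has_real_derivative ?D) _")
proof (rule has_real_derivative_transform)
  show "t \<in> S" by (rule t)
  let ?W = "\<lambda>s. 1/2 * (\<Sum>j=1..J. mass J (X s) j *
    (g (X s (node J j)) powr (-1/2) * (nodal_A J g (X s) (\<kappa> s) j)\<^sup>2 + 2 * lam * g (X s (node J j)) powr (1/2)))"
  show "W_h J g lam (X s) (\<kappa> s) = ?W s" if "s \<in> S" for s
    by (rule polygon.W_h_nodal[OF polygon[OF that] \<kappa>_in_Vh[OF that]])
  let ?m' = "\<lambda>j. (sgn (edge J (X t) j) \<bullet> edge J V j + sgn (edge J (X t) (Suc j)) \<bullet> edge J V (Suc j)) / 2"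
  let ?A' = "\<lambda>j. K (node J j) - 1/2 * (n j \<bullet> (hess lng (x j) *v v j)
       - (n j \<bullet> chord J V j) / norm (chord J (X t) j) * (perp (n j) \<bullet> grad lng (x j)))"
  let ?G = "\<lambda>j. g (x j) powr (-1/2) * (A j)\<^sup>2 + 2 * lam * g (x j) powr (1/2)"
  let ?G' = "\<lambda>j. (-1/2) * g (x j) powr (-1/2) * (v j \<bullet> grad lng (x j)) * (A j)\<^sup>2
    + g (x j) powr (-1/2) * (2 * A j * ?A' j)
    + 2 * lam * ((1/2) * g (x j) powr (1/2) * (v j \<bullet> grad lng (x j)))"
  have "((\<lambda>s. g (X s (node J j)) powr (-1/2) * (nodal_A J g (X s) (\<kappa> s) j)\<^sup>2
      + 2 * lam * g (X s (node J j)) powr (1/2)) has_real_derivative ?G' j) (at t within S)"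
    if j: "j \<in> {1..J}" for j
  proof -
    have "((\<lambda>s. (nodal_A J g (X s) (\<kappa> s) j)\<^sup>2) has_real_derivative 2 * A j * ?A' j) (at t within S)"
      using DERIV_power[OF nodal_A_deriv[OF j], of 2] by (simp add: A_def n_def x_def v_def mult_ac)
    from DERIV_add[OF DERIV_mult[OF powr_deriv this] DERIV_cmult[OF powr_deriv]]
    show ?thesis by (rule DERIV_cong) (simp add: x_def v_def A_def)
  qed
  then have "(?W has_real_derivative 1/2 * (\<Sum>j=1..J. ?m' j * ?G j + ?G' j * mass J (X t) j)) (at t within S)"
    unfolding x_def A_def
    by (intro DERIV_cmult DERIV_sum DERIV_mult mass_deriv) auto
  also have "1/2 * (\<Sum>j=1..J. ?m' j * ?G j + ?G' j * mass J (X t) j) = ?D"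
    unfolding sum_distrib_left sum.distrib[symmetric] sum_subtractf[symmetric]
    by (rule sum.cong) (auto simp: field_simps inner_commute)
  finally show "(?W has_real_derivative ?D) (at t within S)" .
qed

text \<open>The left side of (iii) vanishes on all of \<open>S\<close>, so its derivative by the
  product rule is 0, derivatives at \<open>t\<close> within \<open>S\<close> being unique. The third
  sum stems from the rotation of the unit edges.\<close>

lemma scheme_iii_deriv:
  assumes \<eta>: "\<eta> \<in> Vh J"
  shows "(\<Sum>j=1..J. K (node J j) * (perp (\<eta> (node J j)) \<bullet> (1/2) *\<^sub>R chord J (X t) j))
   + (\<Sum>j=1..J. \<kappa> t (node J j) * (perp (\<eta> (node J j)) \<bullet> (1/2) *\<^sub>R chord J V j))
   + (\<Sum>j=1..J. inverse (norm (edge J (X t) j)) * (perp (sgn (edge J (X t) j)) \<bullet> edge J \<eta> j) *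
       (perp (sgn (edge J (X t) j)) \<bullet> edge J V j)) = 0" (is "?s1 + ?s2 + ?s3 = 0")
proof -
  \<comment> \<open>Inner products are flipped so that the moving factor stands on the left, as
    \<open>has_real_derivative_inner_const\<close> requires.\<close>
  let ?F = "\<lambda>s. (\<Sum>j=1..J. \<kappa> s (node J j) * ((1/2) *\<^sub>R chord J (X s) j \<bullet> perp (\<eta> (node J j))))
    + (\<Sum>j=1..J. sgn (edge J (X s) j) \<bullet> edge J \<eta> j)"
  let ?D = "(\<Sum>j=1..J. K (node J j) * ((1/2) *\<^sub>R chord J (X t) j \<bullet> perp (\<eta> (node J j)))
      + ((1/2) *\<^sub>R chord J V j \<bullet> perp (\<eta> (node J j))) * \<kappa> t (node J j))
    + (\<Sum>j=1..J. (((perp (sgn (edge J (X t) j)) \<bullet> edge J V j) / norm (edge J (X t) j))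
        *\<^sub>R perp (sgn (edge J (X t) j))) \<bullet> edge J \<eta> j)"
  have "(?F has_real_derivative ?D) (at t within S)"
    by (intro DERIV_add DERIV_sum DERIV_mult \<kappa>_deriv has_real_derivative_inner_const
        bounded_linear.has_vector_derivative[OF bounded_linear_scaleR_right] chord_deriv
        has_vector_derivative_sgn edge_deriv edge_nz)
  moreover have "(?F has_real_derivative 0) (at t within S)"
  proof (rule has_real_derivative_transform[OF t _ DERIV_const])
    fix s assume s: "s \<in> S"
    have "?F s = (\<Sum>j=1..J. \<kappa> s (node J j) * (perp (\<eta> (node J j)) \<bullet> (1/2) *\<^sub>R chord J (X s) j))
      + (\<Sum>j=1..J. sgn (edge J (X s) j) \<bullet> edge J \<eta> j)"
      by (simp only: inner_commute[of "perp _"])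
    then show "?F s = 0"
      using polygon.scheme_iii_nodal[OF polygon[OF s] iii[OF s] \<kappa>_in_Vh[OF s] \<eta>] by (rule trans)
  qed
  ultimately have "?D = 0"
    unfolding has_real_derivative_iff_has_vector_derivative
    by (rule vector_derivative_unique_within[OF nontriv])
  moreover have "?D = ?s1 + ?s2 + ?s3"
  proof -
    have "(1/2) *\<^sub>R chord J Z j \<bullet> perp w = perp w \<bullet> (1/2) *\<^sub>R chord J Z j" for Z j w
      by (rule inner_commute)
    moreover have "(((a \<bullet> e) / l) *\<^sub>R a) \<bullet> y = inverse l * (a \<bullet> y) * (a \<bullet> e)" for a e y :: "real^2" and l
      by (simp add: divide_inverse)
    ultimately show ?thesis
      by (simp only: sum.distrib mult.commute[of _ "\<kappa> t _"])
  qed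
  ultimately show ?thesis by (rule trans[OF sym, rotated])
qed

end

theorem theorem4p1:
  fixes H :: "(real^2) set" and g :: "real^2 \<Rightarrow> real" and lam T :: real and J :: nat
    and X Y :: "real \<Rightarrow> real \<Rightarrow> real^2" and \<kappa> :: "real \<Rightarrow> real \<Rightarrow> real"
  assumes "open H" and "smooth_on g H" and "\<And>x. x \<in> H \<Longrightarrow> g x > 0"
    and "J \<ge> 3" and "T > 0"
    and "solves_scheme J g lam T X \<kappa> Y"
    and "\<And>t \<rho>. t \<in> {0<..T} \<Longrightarrow> (\<lambda>s. X s \<rho>) differentiable (at t within {0<..T})"
    and "\<And>t \<rho>. t \<in> {0<..T} \<Longrightarrow> (\<lambda>s. \<kappa> s \<rho>) differentiable (at t within {0<..T})"
    and "\<And>t \<rho>. t \<in> {0..T} \<Longrightarrow> X t \<rho> \<in> H"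
    and "\<And>t j. t \<in> {0..T} \<Longrightarrow> j \<in> {1..J} \<Longrightarrow> X t (node J j) \<noteq> X t (node J (j + 1))"
    and "\<And>t j. t \<in> {0..T} \<Longrightarrow> j \<in> {1..J} \<Longrightarrow> X t (node J (j - 1)) \<noteq> X t (node J (j + 1))"
  shows "\<forall>t\<in>{0<..T}.
    ((\<lambda>s. W_h J g lam (X s) (\<kappa> s)) has_real_derivative
       - ip_h J (\<lambda>\<rho>. g (X t \<rho>) powr (3/2) * (d_t T X t \<rho> \<bullet> omega_h J (X t) \<rho>)\<^sup>2) (len (X t)))
      (at t within {0<..T})"
proof
  have J: "J \<ge> 2" "J > 0" using assms(4) by auto
  have Vh: "X s \<in> Vh J" "\<kappa> s \<in> Vh J" "Y s \<in> Vh J"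
    and scheme: "scheme_i J g lam (X s) (d_t T X s) (\<kappa> s) (Y s)" "scheme_ii J g (X s) (\<kappa> s) (Y s)"
      "scheme_iii J (X s) (\<kappa> s)"
    if "s \<in> {0<..T}" for s
    using assms(6) that unfolding solves_scheme_def by auto
  have polygon: "polygon J (X s) H g" if s: "s \<in> {0<..T}" for s
  proof
    have s': "s \<in> {0..T}" using s by auto
    show "edge J (X s) j \<noteq> 0" if j: "j \<in> {1..J}" for j
    \<comment> \<open>The first edge joins nodes 0 and 1. By periodicity it is the pair of nodes J
      and J+1, which the hypothesis covers with index \<open>J\<close>.\<close>
    proof (cases "j = 1")
      case True
      then show ?thesis
        using assms(10)[OF s', of J] J Vh_node_0[OF Vh(1)[OF s] J(2)] Vh_node_shift[OF Vh(1)[OF s] J(2), of 1]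
        by (auto simp: edge_def)
    next
      case False
      then have "j - 1 \<in> {1..J}" "j - 1 + 1 = j" using j by auto
      then show ?thesis using assms(10)[OF s', of "j - 1"] by (simp add: edge_def)
    qed
    show "chord J (X s) j \<noteq> 0" if j: "j \<in> {1..J}" for j
      using assms(11)[OF s' j] by (simp add: chord_def edge_def)
  qed (use assms J Vh(1)[OF s] s in auto)
  fix t assume t: "t \<in> {0<..T}"
  let ?V = "d_t T X t" and ?K = "d_t T \<kappa> t"
  have V: "?V \<in> Vh J" and K: "?K \<in> Vh J"
    using Vh assms(7,8)[OF t] by (auto intro!: d_t_in_Vh[OF J(1) t])
  interpret moving_polygon J H g "{0<..T}" X ?V \<kappa> ?K t
  proof (rule moving_polygon.intro)
    show "((\<lambda>s. X s \<rho>) has_vector_derivative ?V \<rho>) (at t within {0<..T})" for \<rho>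
      by (rule d_t_works[OF t assms(7)[OF t]])
    show "((\<lambda>s. \<kappa> s \<rho>) has_real_derivative ?K \<rho>) (at t within {0<..T})" for \<rho>
      unfolding has_real_derivative_iff_has_vector_derivative by (rule d_t_works[OF t assms(8)[OF t]])
    show "at t within {0<..T} \<noteq> bot" using t at_within_Ioc_nontrivial by auto
  qed (fact polygon t Vh scheme)+
  show "((\<lambda>s. W_h J g lam (X s) (\<kappa> s)) has_real_derivative
       - ip_h J (\<lambda>\<rho>. g (X t \<rho>) powr (3/2) * (?V \<rho> \<bullet> omega_h J (X t) \<rho>)\<^sup>2) (len (X t)))
      (at t within {0<..T})"
  proof -
    \<comment> \<open>\<open>d\<close> is the dissipation, \<open>s1\<close> to \<open>s6\<close>
      are the sums of (i), \<open>a\<close> is the sum with \<open>K\<close> in the energy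
      derivative and \<open>b\<close> its form by (ii). The last premise is the differentiated (iii)
      with \<open>Y t\<close> as test function, whence a = - (s1 + s6).\<close>
    have balance: "1/2 * s2 - 1/4 * s3 - 1/2 * s4 + 1/2 * s5 + a = - d"
      if "d = L" "L = s1 - 1/2 * s2 + 1/4 * s3 + 1/2 * s4 - 1/2 * s5 + s6" "a = b" "b + s6 + s1 = 0"
      for s1 s2 s3 s4 s5 s6 a b d L :: real
      using that by linarith
    show ?thesis
      by (rule DERIV_cong[OF W_h_deriv],
          rule balance[OF dissipation_nodal[OF V]
            scheme_i_nodal[OF scheme(1)[OF t] Vh(2,3)[OF t] V]
            scheme_ii_nodal[OF scheme(2)[OF t] Vh(2,3)[OF t] K]
            scheme_iii_deriv[OF Vh(3)[OF t]]])
  qed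
qed

end
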